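(* Let $p\geq 2$ and let $G$ be a finite simple $\{pK_2, \mathrm{butterfly}\}$-free graph. Then $\chi(G)\leq f_p(\omega(G))$, where $f_p:\mathbb{N}\to\mathbb{N}$ ($p\geq2$) is defined by: $f_t(1)=1$ for $t\geq2$; $f_2(2)=3$; $f_2(3)=4$; $f_2(s)=\binom{s+1}{2}$ for $s\geq 4$; $f_p(2)=2p-2$ for $p\geq 3$; and $f_p(m)=f_{p-1}(m)+\binom{m+1}{2}-1$ for $m,p\geq 3$.
   Context: $\chi(G)$ is the chromatic number and $\omega(G)$ the clique number of $G$. $pK_2$ is the disjoint union of $p$ edges. The butterfly is the graph on five vertices consisting of two triangles sharing exactly one vertex. A graph is $\mathcal{F}$-free if it has no induced subgraph isomorphic to a member of $\mathcal{F}$. *)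

theory Defs
  imports "Graph_Theory.Pair_Digraph" "Graph_Theory.Digraph_Component"
    "Graph_Theory.Digraph_Isomorphism"
begin

text \<open>
  Finite simple graphs are rendered by the locale \<open>pair_graph\<close>: finite vertex set, and a
  loop-free symmetric set of arcs, an edge \<open>uv\<close> being the pair of arcs \<open>(u, v)\<close>, \<open>(v, u)\<close>.
\<close>

definition free_of :: "'b pair_pre_digraph set \<Rightarrow> 'a pair_pre_digraph \<Rightarrow> bool" where
  "free_of \<F> G \<longleftrightarrow>
    \<not> (\<exists>F\<in>\<F>. \<exists>H. induced_subgraph H (with_proj G) \<and> digraph_iso H (with_proj F))"

definition matching_graph :: "nat \<Rightarrow> nat pair_pre_digraph" where
  "matching_graph p = \<lparr> pverts = {..<2 * p},
     parcs = (\<Union>i<p. {(2 * i, 2 * i + 1), (2 * i + 1, 2 * i)}) \<rparr>"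

definition butterfly :: "nat pair_pre_digraph" where
  "butterfly = (let E = {(0, 1), (0, 2), (1, 2), (0, 3), (0, 4), (3, 4)}
     in \<lparr> pverts = {0, 1, 2, 3, 4}, parcs = E \<union> E\<inverse> \<rparr>)"

definition clique :: "'a pair_pre_digraph \<Rightarrow> 'a set \<Rightarrow> bool" where
  "clique G K \<longleftrightarrow> K \<subseteq> pverts G \<and> pairwise (\<lambda>u v. (u, v) \<in> parcs G) K"

definition clique_number :: "'a pair_pre_digraph \<Rightarrow> nat" where
  "clique_number G = Max {card K | K. clique G K}"

definition proper_coloring :: "'a pair_pre_digraph \<Rightarrow> nat \<Rightarrow> ('a \<Rightarrow> nat) \<Rightarrow> bool" where
  "proper_coloring G k c \<longleftrightarrow>
    c ` pverts G \<subseteq> {..<k} \<and> (\<forall>(u, v)\<in>parcs G. c u \<noteq> c v)"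

definition chromatic_number :: "'a pair_pre_digraph \<Rightarrow> nat" where
  "chromatic_number G = (LEAST k. \<exists>c. proper_coloring G k c)"

text \<open>
  The function is specified for \<open>p \<ge> 2\<close> and \<open>m \<ge> 1\<close> only; all other values are arbitrary.
  The value \<open>0\<close> at \<open>m = 0\<close> makes the bound hold for the graph without vertices, the only one
  of clique number \<open>0\<close>.
\<close>

fun chi_bound :: "nat \<Rightarrow> nat \<Rightarrow> nat" where
  "chi_bound p m =
    (if m = 0 then 0
     else if m = 1 then 1
     else if p \<le> 2 then (if m = 2 then 3 else if m = 3 then 4 else (m + 1) choose 2)
     else if m = 2 then 2 * p - 2
     else chi_bound (p - 1) m + ((m + 1) choose 2) - 1)"

declare chi_bound.simps [simp del]

lemma chi_bound_clauses:
  "t \<ge> 2 \<Longrightarrow> chi_bound t 1 = 1"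
  "chi_bound 2 2 = 3"
  "chi_bound 2 3 = 4"
  "s \<ge> 4 \<Longrightarrow> chi_bound 2 s = (s + 1) choose 2"
  "p \<ge> 3 \<Longrightarrow> chi_bound p 2 = 2 * p - 2"
  "m \<ge> 3 \<Longrightarrow> p \<ge> 3 \<Longrightarrow> chi_bound p m = chi_bound (p - 1) m + ((m + 1) choose 2) - 1"
  by (subst chi_bound.simps; simp)+

lemma pair_graph_matching_graph: "pair_graph (matching_graph p)"
  by unfold_locales (auto simp: matching_graph_def arcs_ends_def symmetric_def sym_def arc_to_ends_def)

lemma pair_graph_butterfly: "pair_graph butterfly"
  by unfold_locales (auto simp: butterfly_def Let_def symmetric_def sym_def)

end

theory Submission
  imports Defs
begin

text \<open>
  Colour every vertex by the first two vertices of a maximum clique that it misses. In a butterfly-free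
  graph this is proper on the neighbours of the first two clique vertices, where the pair \<open>(0, 1)\<close>
  does not occur, and the remaining vertices induce a \<open>(p - 1)K\<^sub>2\<close>-free graph; this is the
  recursion for \<open>p \<ge> 3\<close>. If \<open>p = 2\<close>, the colouring is proper on the whole graph (Wagon's bound).
  Two cases remain: \<open>(2K\<^sub>2, K\<^sub>4)\<close>-free graphs and \<open>(3K\<^sub>2, K\<^sub>3)\<close>-free graphs are 4-colourable.

  For these, one shows for more and more small graphs \<open>J\<close> that a minimal counterexample cannot contain
  them. Given an induced copy of \<open>J\<close>, every vertex has a type, its adjacency to the copy. If the types
  which do not create a graph excluded earlier can be coloured such that two adjacent vertices of equal
  colour always create an excluded graph, then \<open>J\<close> is excluded as well. Another reason is that a vertex
  of \<open>J\<close> is dominated by another one, which cannot happen in a critical graph. A finite list of such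
  steps almost suffices. In the \<open>(2K\<^sub>2, K\<^sub>4)\<close>-free case, a pentagon may be surrounded by a circular
  structure of unbounded size, which calls for an extremal argument. In the \<open>(3K\<^sub>2, K\<^sub>3)\<close>-free case,
  the nonneighbours of an edge induce a graph that is \<open>2K\<^sub>2\<close>-free, triangle-free and not bipartite, so
  that each of its edges lies on a pentagon.
\<close>

section \<open>Colourability\<close>

definition colorable :: "('a \<Rightarrow> 'a \<Rightarrow> bool) \<Rightarrow> 'a set \<Rightarrow> nat \<Rightarrow> bool" where
  "colorable E V k \<longleftrightarrow> (\<exists>c. c ` V \<subseteq> {..<k} \<and> (\<forall>u\<in>V. \<forall>v\<in>V. E u v \<longrightarrow> c u \<noteq> c v))"

lemma colorableI:
  assumes "finite C" "card C \<le> k" "c ` V \<subseteq> C" "\<And>u v. u \<in> V \<Longrightarrow> v \<in> V \<Longrightarrow> E u v \<Longrightarrow> c u \<noteq> c v"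
  shows "colorable E V k"
proof -
  obtain f where f: "bij_betw f C {..<card C}"
    using assms(1) finite_same_card_bij[of C "{..<card C}"] by auto
  have "(f \<circ> c) ` V \<subseteq> {..<k}"
    using f assms(2) image_mono[OF assms(3), of f] by (auto simp: bij_betw_def image_comp)
  moreover have "(f \<circ> c) u \<noteq> (f \<circ> c) v" if "u \<in> V" "v \<in> V" "E u v" for u v
    using assms(3,4) that f by (auto simp: bij_betw_def dest!: inj_onD)
  ultimately show ?thesis
    unfolding colorable_def by blast
qed

lemma colorable_mono: "colorable E V k \<Longrightarrow> k \<le> l \<Longrightarrow> colorable E V l"
  unfolding colorable_def by (meson lessThan_subset_iff order_trans)

lemma colorable_subset: "colorable E V k \<Longrightarrow> W \<subseteq> V \<Longrightarrow> colorable E W k"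
  unfolding colorable_def by (meson image_mono order_trans subsetD)

lemma colorable_Un:
  assumes "colorable E U a" "colorable E W b"
  shows "colorable E (U \<union> W) (a + b)"
proof -
  obtain c d where c: "c ` U \<subseteq> {..<a}" "\<forall>u\<in>U. \<forall>v\<in>U. E u v \<longrightarrow> c u \<noteq> c v"
    and d: "d ` W \<subseteq> {..<b}" "\<forall>u\<in>W. \<forall>v\<in>W. E u v \<longrightarrow> d u \<noteq> d v"
    using assms unfolding colorable_def by auto
  define e where "e v = (if v \<in> U then Inl (c v) else Inr (d v))" for v
  show ?thesis
  proof (rule colorableI)
    show "e ` (U \<union> W) \<subseteq> {..<a} <+> {..<b}" using c(1) d(1) by (auto simp: e_def)
    show "e u \<noteq> e v" if "u \<in> U \<union> W" "v \<in> U \<union> W" "E u v" for u v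
      using that c(2) d(2) by (auto simp: e_def)
  qed (simp_all add: card_Plus)
qed

lemma colorable_1_if_edgeless: "(\<And>u v. u \<in> V \<Longrightarrow> v \<in> V \<Longrightarrow> \<not> E u v) \<Longrightarrow> colorable E V 1"
  unfolding colorable_def by (intro exI[of _ "\<lambda>_. 0"]) auto

lemma ex_edge_if_not_colorable:
  assumes "\<not> colorable E V k" "0 < k"
  obtains u v where "u \<in> V" "v \<in> V" "E u v"
  using assms colorable_1_if_edgeless[of V E] colorable_mono[of E V 1 k] by (metis One_nat_def Suc_leI)


section \<open>Induced copies of small graphs\<close>

text \<open>
  A graph on the vertices \<open>0, \<dots>, n - 1\<close> is the list of its rows, row \<open>i\<close> being the adjacency of \<open>i\<close>
  to \<open>i + 1, \<dots>, n - 1\<close>. Prepending a row adds a vertex and shifts the numbers of the others by one.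
\<close>

type_synonym rows = "bool list list"

fun adj :: "rows \<Rightarrow> nat \<Rightarrow> nat \<Rightarrow> bool" where
  "adj [] i j = False"
| "adj (r # G) 0 0 = False"
| "adj (r # G) 0 (Suc j) = r ! j"
| "adj (r # G) (Suc i) 0 = r ! i"
| "adj (r # G) (Suc i) (Suc j) = adj G i j"

text \<open>
  The vertices of a copy need not be distinct: two of them may coincide if they have the same neighbours
  in the small graph.
\<close>

fun copy :: "('a \<Rightarrow> 'a \<Rightarrow> bool) \<Rightarrow> 'a set \<Rightarrow> 'a list \<Rightarrow> rows \<Rightarrow> bool" where
  "copy E V [] [] \<longleftrightarrow> True"
| "copy E V (x # xs) (r # G) \<longleftrightarrow> (if map (E x) xs = r then x \<in> V \<and> copy E V xs G else False)"
| "copy E V _ _ \<longleftrightarrow> False"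

definition contains :: "('a \<Rightarrow> 'a \<Rightarrow> bool) \<Rightarrow> 'a set \<Rightarrow> rows \<Rightarrow> bool" where
  "contains E V G \<longleftrightarrow> (\<exists>xs. copy E V xs G)"

definition avoids :: "('a \<Rightarrow> 'a \<Rightarrow> bool) \<Rightarrow> 'a set \<Rightarrow> rows list \<Rightarrow> bool" where
  "avoids E V P \<longleftrightarrow> (\<forall>G\<in>set P. \<not> contains E V G)"

fun matching_rows :: "nat \<Rightarrow> rows" where
  "matching_rows 0 = []"
| "matching_rows (Suc p) = (True # replicate (2 * p) False) # replicate (2 * p) False # matching_rows p"

fun clique_rows :: "nat \<Rightarrow> rows" where
  "clique_rows 0 = []"
| "clique_rows (Suc m) = replicate m True # clique_rows m"

definition rows_of :: "nat list list \<Rightarrow> rows" where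
  "rows_of ns = map (\<lambda>(i, js). map (\<lambda>j. j \<in> set js) [Suc i..<length ns]) (List.enumerate 0 ns)"

lemma copy_length: "copy E V xs G \<Longrightarrow> length xs = length G"
  by (induction E V xs G rule: copy.induct) (auto split: if_splits)

lemma copy_in: "copy E V xs G \<Longrightarrow> set xs \<subseteq> V"
  by (induction E V xs G rule: copy.induct) (auto split: if_splits)

lemma copy_mono: "copy E V xs G \<Longrightarrow> set xs \<subseteq> W \<Longrightarrow> copy E W xs G"
  by (induction E V xs G rule: copy.induct) (auto split: if_splits)

lemma contains_mono: "contains E W G \<Longrightarrow> W \<subseteq> V \<Longrightarrow> contains E V G"
  unfolding contains_def by (meson copy_in copy_mono order_trans)

lemma avoids_subset: "avoids E V P \<Longrightarrow> W \<subseteq> V \<Longrightarrow> avoids E W P"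
  unfolding avoids_def using contains_mono by blast

lemma avoids_Cons [simp]: "avoids E V (G # P) \<longleftrightarrow> \<not> contains E V G \<and> avoids E V P"
  by (simp add: avoids_def)

lemma avoids_Nil [simp]: "avoids E V []"
  by (simp add: avoids_def)

lemma avoids_append [simp]: "avoids E V (P @ Q) \<longleftrightarrow> avoids E V P \<and> avoids E V Q"
  by (auto simp: avoids_def)

lemma map_eq_replicate_iff: "map f xs = replicate n y \<longleftrightarrow> length xs = n \<and> (\<forall>x\<in>set xs. f x = y)"
  by (auto simp: list_eq_iff_nth_eq all_set_conv_all_nth)

lemma copy_clique_rows_iff:
  "copy E V xs (clique_rows m) \<longleftrightarrow> length xs = m \<and> set xs \<subseteq> V \<and> sorted_wrt E xs"
proof (induction m arbitrary: xs)
  case (Suc m)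
  then show ?case
    by (cases xs) (auto simp: map_eq_replicate_iff)
qed (metis clique_rows.simps(1) copy.simps(1,3) length_0_conv neq_Nil_conv set_empty empty_subsetI
    sorted_wrt.simps(1))

lemma copy_restrict: "copy E {v \<in> V. P v} xs G \<longleftrightarrow> copy E V xs G \<and> (\<forall>v\<in>set xs. P v)"
  by (induction E V xs G rule: copy.induct) auto

lemma length_matching_rows [simp]: "length (matching_rows p) = 2 * p"
  by (induction p) auto

definition C5 :: rows where
  "C5 = rows_of [[1,4],[2],[3],[4],[]]"

lemma C5_rows: "C5 = [[True, False, False, True], [True, False, False], [True, False], [True], []]"
  by code_simp

locale simple_graph =
  fixes E :: "'a \<Rightarrow> 'a \<Rightarrow> bool" and V :: "'a set"
  assumes sym: "E u v \<Longrightarrow> E v u" and irrefl: "\<not> E v v"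
begin

lemma comm: "E u v \<longleftrightarrow> E v u"
  using sym by blast

lemma adj_copy:
  "copy E V xs G \<Longrightarrow> i < length G \<Longrightarrow> j < length G \<Longrightarrow> adj G i j \<longleftrightarrow> E (xs ! i) (xs ! j)"
proof (induction G i j arbitrary: xs rule: adj.induct)
  case (3 r G j)
  then show ?case by (cases xs) (auto dest!: copy_length split: if_splits)
next
  case (4 r G i)
  then show ?case by (cases xs) (auto simp: comm dest!: copy_length split: if_splits)
next
  case (5 r G i j)
  then show ?case by (cases xs) (auto split: if_splits)
qed (auto simp: irrefl)

lemma copy_trans:
  assumes "copy E V xs G"
  shows "copy (adj G) {..<length G} js Q \<Longrightarrow> copy E V (map ((!) xs) js) Q"
proof (induction js arbitrary: Q)
  case (Cons i js)
  obtain r Q' where Q: "Q = r # Q'" "map (adj G i) js = r" "i < length G" "copy (adj G) {..<length G} js Q'"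
    using Cons.prems by (cases Q) (auto split: if_splits)
  have "set js \<subseteq> {..<length G}" using copy_in[OF Q(4)] .
  then have "map (E (xs ! i)) (map ((!) xs) js) = r"
    using Q(2,3) adj_copy[OF assms] by (auto simp: subset_iff)
  moreover have "xs ! i \<in> V" using Q(3) copy_length[OF assms] copy_in[OF assms] by (metis nth_mem subsetD)
  ultimately show ?case using Cons.IH[OF Q(4)] Q(1) by simp
qed (metis copy.simps(1,4) neq_Nil_conv list.map(1))

lemma contains_trans: "copy E V xs G \<Longrightarrow> copy (adj G) {..<length G} js Q \<Longrightarrow> contains E V Q"
  using copy_trans contains_def by metis

lemma contains_matching_rows_Suc:
  assumes "x \<in> V" "y \<in> V" "E x y" "contains E {v \<in> V. \<not> E v x \<and> \<not> E v y} (matching_rows p)"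
  shows "contains E V (matching_rows (Suc p))"
proof -
  obtain xs where "copy E {v \<in> V. \<not> E v x \<and> \<not> E v y} xs (matching_rows p)"
    using assms(4) unfolding contains_def by blast
  then have "copy E V (x # y # xs) (matching_rows (Suc p))"
    using assms(1-3) comm by (auto simp: copy_restrict map_eq_replicate_iff dest: copy_length)
  then show ?thesis unfolding contains_def by blast
qed

lemma edges_joined_if_2K2_free:
  assumes "\<not> contains E V (matching_rows 2)" "{a, b, c, d} \<subseteq> V" "E a b" "E c d"
  shows "E a c \<or> E a d \<or> E b c \<or> E b d"
proof (rule ccontr)
  assume "\<not> ?thesis"
  then have "copy E V [a, b, c, d] (matching_rows 2)"
    using assms(2-4) by (simp add: numeral_2_eq_2)
  then show False using assms(1) unfolding contains_def by blast
qed

lemma no_clique: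
  "\<not> contains E V (clique_rows m) \<Longrightarrow> length xs = m \<Longrightarrow> set xs \<subseteq> V \<Longrightarrow> \<not> sorted_wrt E xs"
  unfolding contains_def copy_clique_rows_iff by blast

lemma no_triangle:
  "\<not> contains E V (clique_rows 3) \<Longrightarrow> {a, b, c} \<subseteq> V \<Longrightarrow> E a b \<Longrightarrow> E a c \<Longrightarrow> \<not> E b c"
  using no_clique[of 3 "[a, b, c]"] by auto

lemma copy_C5_iff:
  "copy E V [a, b, c, d, e] C5 \<longleftrightarrow> {a, b, c, d, e} \<subseteq> V \<and> E a b \<and> E b c \<and> E c d \<and> E d e \<and> E e a \<and>
    \<not> E a c \<and> \<not> E b d \<and> \<not> E c e \<and> \<not> E d a \<and> \<not> E e b"
  by (auto simp: C5_rows comm)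

lemma colorable_2_if_neighbours_separated:
  assumes "\<not> contains E V (matching_rows 2)" "\<not> contains E V (clique_rows 3)"
    and ab: "a \<in> V" "b \<in> V" "E a b"
    and separated: "\<And>z u v. {z, u, v} \<subseteq> V \<Longrightarrow> \<not> E z a \<Longrightarrow> \<not> E z b \<Longrightarrow> E u a \<Longrightarrow> E v b \<Longrightarrow> E z u \<Longrightarrow> \<not> E z v"
  shows "colorable E V 2"
proof -
  note triangle = no_triangle[OF assms(2)]
  have meets_ab: "E x a \<or> E x b \<or> E y a \<or> E y b" if "x \<in> V" "y \<in> V" "E x y" for x y
    using edges_joined_if_2K2_free[OF assms(1), of x y a b] that ab by auto
  define right where "right x \<longleftrightarrow> E x b \<or> \<not> E x a \<and> (\<exists>u\<in>V. E u a \<and> E x u)" for x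
  have "right x \<longleftrightarrow> \<not> right y" if xy: "x \<in> V" "y \<in> V" "E x y" for x y
  proof
    show "\<not> right y" if "right x"
    proof
      assume "right y"
      with \<open>right x\<close> consider "E x b" "E y b" | "E x b" "\<not> E y a" "\<not> E y b" "\<exists>u\<in>V. E u a \<and> E y u"
        | "E y b" "\<not> E x a" "\<not> E x b" "\<exists>u\<in>V. E u a \<and> E x u"
        | "\<not> E x a" "\<not> E x b" "\<not> E y a" "\<not> E y b"
        unfolding right_def by blast
      then show False
        using separated[of x _ y] separated[of y _ x] triangle[of x y b] meets_ab[OF xy] xy ab(2) sym[OF xy(3)]
        by cases auto
    qed
    show "right x" if "\<not> right y"
    proof (rule ccontr)
      assume "\<not> right x"
      with \<open>\<not> right y\<close> have "E x a \<or> E y a" using meets_ab[OF xy] unfolding right_def by blast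
      then show False
        using \<open>\<not> right x\<close> \<open>\<not> right y\<close> triangle[of x y a] xy ab(1) sym[OF xy(3)] unfolding right_def by blast
    qed
  qed
  then show ?thesis
    unfolding colorable_def by (intro exI[of _ "\<lambda>x. if right x then 1 else 0"]) auto
qed

lemma ex_pentagon_through_edge:
  assumes "\<not> contains E V (matching_rows 2)" "\<not> contains E V (clique_rows 3)" "\<not> colorable E V 2"
    and ab: "a \<in> V" "b \<in> V" "E a b"
  obtains v z u where "copy E V [a, b, v, z, u] C5"
proof -
  obtain z u v where "{z, u, v} \<subseteq> V" "\<not> E z a" "\<not> E z b" "E u a" "E v b" "E z u" "E z v"
    using colorable_2_if_neighbours_separated[OF assms(1,2) ab] assms(3) by metis
  then have "copy E V [a, b, v, z, u] C5"
    using ab no_triangle[OF assms(2), of z u v] no_triangle[OF assms(2), of a b u]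
      no_triangle[OF assms(2), of b a v] comm
    by (auto simp: copy_C5_iff)
  then show thesis by (rule that)
qed

end


section \<open>Certified exclusion of induced subgraphs\<close>

text \<open>
  The type of a vertex is its adjacency to a given copy of \<open>J\<close>. Copies of a base pattern \<open>Q\<close> which use
  new vertices are searched for. Base patterns come as pairs \<open>(Q, R)\<close>: where \<open>R\<close> has an entry \<open>True\<close>,
  the two vertices of \<open>Q\<close> may be assumed to be embedded in increasing order, by symmetry. All other
  copies are prescribed by hints: \<open>(k, js)\<close> embeds the \<open>k\<close>-th pattern excluded so far along \<open>js\<close>,
  where the new vertices come first.

  Recursive tests are written with conditionals, as these are evaluated lazily by \<open>code_simp\<close> and
  conjunctions are not.
\<close>

fun increasing :: "nat \<Rightarrow> nat list \<Rightarrow> bool list \<Rightarrow> bool" where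
  "increasing i (j # js) (b # bs) \<longleftrightarrow>
     (if b then if i < j then increasing i js bs else False else increasing i js bs)"
| "increasing i _ _ \<longleftrightarrow> True"

fun copies :: "rows \<Rightarrow> rows \<Rightarrow> rows \<Rightarrow> nat list list" where
  "copies G (q # Q) (r # R) = concat (map (\<lambda>js. map (\<lambda>i. i # js)
     (filter (\<lambda>i. if increasing i js r then map (adj G i) js = q else False) [0..<length G])) (copies G Q R))"
| "copies G [] R = [[]]"
| "copies G (q # Q) [] = []"

lemma copies_sound: "js \<in> set (copies G Q R) \<Longrightarrow> copy (adj G) {..<length G} js Q"
  by (induction G Q R arbitrary: js rule: copies.induct) (auto split: if_splits)

definition completions :: "(rows \<times> rows) list \<Rightarrow> rows \<Rightarrow> (nat list \<times> bool list) list" where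
  "completions B J = concat (map (\<lambda>(Q, R). map (\<lambda>js. (js, hd Q)) (copies J (tl Q) (tl R))) B)"

definition edge_completions :: "(rows \<times> rows) list \<Rightarrow> rows \<Rightarrow> (nat list \<times> bool list \<times> bool list) list" where
  "edge_completions B J = concat (map (\<lambda>(Q, R). case Q of
     (True # p) # q # Q' \<Rightarrow> map (\<lambda>js. (js, p, q)) (copies J Q' (drop 2 R)) | _ \<Rightarrow> []) B)"

fun labelled :: "bool list \<Rightarrow> nat list \<Rightarrow> bool list \<Rightarrow> bool" where
  "labelled t [] [] \<longleftrightarrow> True"
| "labelled t (j # js) (b # q) \<longleftrightarrow> (if t ! j = b then labelled t js q else False)"
| "labelled t _ _ \<longleftrightarrow> False"

definition unmatched :: "('c \<Rightarrow> 'b \<Rightarrow> bool) \<Rightarrow> 'c list \<Rightarrow> 'b list \<Rightarrow> 'b list" where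
  "unmatched R cs xs = filter (\<lambda>x. find (\<lambda>c. R c x) cs = None) xs"

definition hinted_copies :: "rows list \<Rightarrow> (nat \<times> nat list) list \<Rightarrow> (rows \<times> nat list) list" where
  "hinted_copies P hs = concat (map (\<lambda>(k, js). if k < length P then [(P ! k, js)] else []) hs)"

fun base_types :: "(rows \<times> rows) list \<Rightarrow> rows \<Rightarrow> bool list list" where
  "base_types B [] = [[]]"
| "base_types B (r # J) = unmatched (\<lambda>(js, q) t. labelled t js q)
     (filter (\<lambda>(js, q). 0 \<in> set js) (completions B (r # J)))
     (concat (map (\<lambda>t. [False # t, True # t]) (base_types B J)))"

definition possible_types :: "(rows \<times> rows) list \<Rightarrow> rows list \<Rightarrow> (nat \<times> nat list) list \<Rightarrow> rows \<Rightarrow>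
    bool list list" where
  "possible_types B P hs J =
     unmatched (\<lambda>(Q, js) t. copy (adj (t # J)) {..<Suc (length J)} js Q) (hinted_copies P hs)
       (base_types B J)"

definition labelled_types :: "(rows \<times> rows) list \<Rightarrow> rows list \<Rightarrow> (nat \<times> nat list) list \<Rightarrow> rows \<Rightarrow>
    nat list \<Rightarrow> bool list \<Rightarrow> bool list list" where
  "labelled_types B P hs J js q = filter (\<lambda>t. labelled t js q) (possible_types B P hs J)"

definition joinable_pairs :: "(rows \<times> rows) list \<Rightarrow> rows list \<Rightarrow> (nat \<times> nat list) list \<Rightarrow> rows \<Rightarrow>
    (bool list \<times> bool list) list \<Rightarrow> (bool list \<times> bool list) list" where
  "joinable_pairs B P hs J ps =
     unmatched (\<lambda>(Q, js) (s, t). copy (adj ((True # s) # t # J)) {..<Suc (Suc (length J))} js Q)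
       (hinted_copies P hs)
       (unmatched (\<lambda>(js, p, q) (s, t). if labelled s js p then labelled t js q else False)
         (edge_completions B J) ps)"

lemma labelled_iff: "labelled t js q \<longleftrightarrow> map ((!) t) js = q"
  by (induction t js q rule: labelled.induct) auto

lemma set_unmatched: "set (unmatched R cs xs) = {x \<in> set xs. \<forall>c\<in>set cs. \<not> R c x}"
  by (auto simp: unmatched_def find_None_iff)

context simple_graph
begin

lemma copy_completion:
  assumes "copy E V xs J" "js \<in> set (copies J Q R)" "v \<in> V" "map ((!) (map (E v) xs)) js = q"
  shows "copy E V (v # map ((!) xs) js) (q # Q)"
proof -
  note js = copies_sound[OF assms(2)]
  have "map ((!) (map (E v) xs)) js = map (E v) (map ((!) xs) js)"
    using copy_in[OF js] copy_length[OF assms(1)] by auto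
  then show ?thesis using copy_trans[OF assms(1) js] assms(3,4) by simp
qed

lemma completions_sound:
  assumes "avoids E V (map fst B)" "copy E V xs J" "v \<in> V" "(js, q) \<in> set (completions B J)"
  shows "map ((!) (map (E v) xs)) js \<noteq> q"
proof
  assume "map ((!) (map (E v) xs)) js = q"
  moreover obtain Q R where Q: "Q \<in> set (map fst B)" "js \<in> set (copies J (tl Q) R)" "q = hd Q"
    using assms(4) unfolding completions_def by force
  ultimately have "copy E V (v # map ((!) xs) js) (q # tl Q)"
    using copy_completion[OF assms(2) Q(2) assms(3)] by simp
  moreover have "Q \<noteq> []"
    using Q(1) assms(1) copy.simps(1) unfolding avoids_def contains_def by blast
  ultimately show False
    using Q(1,3) assms(1) unfolding avoids_def contains_def by auto
qed

lemma edge_completions_sound: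
  assumes "avoids E V (map fst B)" "copy E V xs J" "u \<in> V" "v \<in> V" "E u v"
    and "(js, p, q) \<in> set (edge_completions B J)" "map ((!) (map (E u) xs)) js = p"
  shows "map ((!) (map (E v) xs)) js \<noteq> q"
proof
  assume "map ((!) (map (E v) xs)) js = q"
  moreover obtain Q R where Q: "(True # p) # q # Q \<in> set (map fst B)" "js \<in> set (copies J Q R)"
    using assms(6) unfolding edge_completions_def by (force split: list.splits bool.splits)
  ultimately have "copy E V (v # map ((!) xs) js) (q # Q)" "copy E V (u # map ((!) xs) js) (p # Q)"
    using copy_completion[OF assms(2) Q(2)] assms(3,4,7) by blast+
  then have "copy E V (u # v # map ((!) xs) js) ((True # p) # q # Q)"
    using assms(5) by (auto split: if_splits)
  then show False using Q(1) assms(1) unfolding avoids_def contains_def by blast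
qed

lemma hinted_copies_sound:
  assumes "avoids E V P" "copy E V xs G" "(Q, js) \<in> set (hinted_copies P hs)"
  shows "\<not> copy (adj G) {..<length G} js Q"
  using assms(1,3) contains_trans[OF assms(2)] nth_mem unfolding hinted_copies_def avoids_def
  by (fastforce split: if_splits)

lemma base_types_complete:
  assumes "avoids E V (map fst B)" "v \<in> V"
  shows "copy E V xs J \<Longrightarrow> map (E v) xs \<in> set (base_types B J)"
proof (induction J arbitrary: xs)
  case Nil
  then show ?case by (cases xs) auto
next
  case (Cons r J)
  then obtain x ys where xs: "xs = x # ys" "copy E V ys J" by (cases xs) (auto split: if_splits)
  then show ?case
    using Cons.IH[OF xs(2)] completions_sound[OF assms(1) Cons.prems assms(2)]
    by (auto simp: set_unmatched labelled_iff intro!: bexI[of _ "map (E v) ys"])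
qed

lemma possible_types_complete:
  assumes "avoids E V (map fst B)" "avoids E V P" "copy E V xs J" "v \<in> V"
  shows "map (E v) xs \<in> set (possible_types B P hs J)"
  using base_types_complete[OF assms(1,4,3)] assms(3,4)
    hinted_copies_sound[OF assms(2), of "v # xs" "map (E v) xs # J"]
  by (auto simp: possible_types_def set_unmatched)

lemma labelled_types_complete:
  assumes "avoids E V (map fst B)" "avoids E V P" "copy E V xs J" "v \<in> V"
    and "set js \<subseteq> {..<length xs}" "map (E v) (map ((!) xs) js) = q"
  shows "map (E v) xs \<in> set (labelled_types B P hs J js q)"
  using possible_types_complete[OF assms(1-4)] assms(5,6)
  by (auto simp: labelled_types_def labelled_iff subset_iff)

lemma joinable_pairs_complete:
  assumes "avoids E V (map fst B)" "avoids E V P" "copy E V xs J" "u \<in> V" "v \<in> V" "E u v"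
    and "(map (E u) xs, map (E v) xs) \<in> set ps"
  shows "(map (E u) xs, map (E v) xs) \<in> set (joinable_pairs B P hs J ps)"
  using assms(7) edge_completions_sound[OF assms(1,3-6)] assms(3-6)
    hinted_copies_sound[OF assms(2), of "u # v # xs" "(True # map (E u) xs) # map (E v) xs # J"]
  by (auto simp: joinable_pairs_def set_unmatched labelled_iff)

end

fun same_pairs :: "('b \<times> 'c) list \<Rightarrow> ('b \<times> 'b) list" where
  "same_pairs [] = []"
| "same_pairs ((s, c) # ls) = map (\<lambda>(t, d). (s, t)) (filter (\<lambda>(t, d). d = c) ((s, c) # ls)) @ same_pairs ls"

lemma same_pairs_complete:
  "(s, c) \<in> set ls \<Longrightarrow> (t, c) \<in> set ls \<Longrightarrow> (s, t) \<in> set (same_pairs ls) \<or> (t, s) \<in> set (same_pairs ls)"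
  by (induction ls rule: same_pairs.induct) force+

text \<open>
  \<open>Colour cs hs\<close> gives the colours of the possible types; \<open>hs\<close> are hints for adjacent vertices of equal colour.
  \<open>Fold a b\<close> claims that the neighbourhood of \<open>a\<close> is contained in that of \<open>b\<close>.
\<close>

datatype reason = Colour "nat list" "(nat \<times> nat list) list" | Fold nat nat

fun refutes :: "nat \<Rightarrow> (rows \<times> rows) list \<Rightarrow> rows list \<Rightarrow> (nat \<times> nat list) list \<Rightarrow> rows \<Rightarrow> reason \<Rightarrow> bool" where
  "refutes k B P hs J (Colour cs ws) \<longleftrightarrow> (let ts = possible_types B P hs J in
     length cs = length ts \<and> list_all (\<lambda>c. c < k) cs \<and> joinable_pairs B P ws J (same_pairs (zip ts cs)) = [])"
| "refutes k B P hs J (Fold a b) \<longleftrightarrow> a < length J \<and> b < length J \<and>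
     map (adj J a) [0..<length J] \<noteq> map (adj J b) [0..<length J] \<and>
     labelled_types B P hs J [a, b] [True, False] = []"

fun refutes_all :: "nat \<Rightarrow> (rows \<times> rows) list \<Rightarrow> rows list \<Rightarrow>
    (nat list list \<times> (nat \<times> nat list) list \<times> reason) list \<Rightarrow> bool" where
  "refutes_all k B P [] \<longleftrightarrow> True"
| "refutes_all k B P ((ns, hs, r) # ss) \<longleftrightarrow>
    (if refutes k B P hs (rows_of ns) r then refutes_all k B (P @ [rows_of ns]) ss else False)"

locale critical_graph = simple_graph +
  fixes k :: nat
  assumes finite: "finite V" and not_colorable: "\<not> colorable E V k"
    and critical: "W \<subset> V \<Longrightarrow> colorable E W k"
begin

lemma not_dominated:
  assumes "x \<in> V" "y \<in> V" "x \<noteq> y"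
  obtains v where "v \<in> V" "E v x" "\<not> E v y"
proof (rule ccontr)
  assume "\<not> thesis"
  with that have dominated: "E v y" if "v \<in> V" "E v x" for v using that by blast
  obtain d where d: "d ` (V - {x}) \<subseteq> {..<k}" "\<forall>u\<in>V - {x}. \<forall>v\<in>V - {x}. E u v \<longrightarrow> d u \<noteq> d v"
    using critical[of "V - {x}"] assms unfolding colorable_def by auto
  have "\<not> E x y" using dominated[OF assms(2)] irrefl sym by blast
  then have "(d(x := d y)) u \<noteq> (d(x := d y)) v" if "u \<in> V" "v \<in> V" "E u v" for u v
    using that d(2) dominated irrefl assms by (auto simp: comm)
  moreover have "(d(x := d y)) ` V \<subseteq> {..<k}" using d(1) assms by auto
  ultimately show False using not_colorable unfolding colorable_def by blast
qed

lemma copy_colour_refuted: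
  assumes "avoids E V (map fst B)" "avoids E V P" "refutes k B P hs J (Colour cs ws)"
  shows "\<not> copy E V xs J"
proof
  assume copy: "copy E V xs J"
  define coloured where "coloured = zip (possible_types B P hs J) cs"
  define col where "col v = (SOME c. (map (E v) xs, c) \<in> set coloured)" for v
  have col: "(map (E v) xs, col v) \<in> set coloured" if "v \<in> V" for v
  proof -
    have "map (E v) xs \<in> set (map fst coloured)"
      using possible_types_complete[OF assms(1,2) copy that] assms(3) by (simp add: coloured_def Let_def)
    then show ?thesis unfolding col_def by (intro someI_ex[of "\<lambda>c. (map (E v) xs, c) \<in> set coloured"]) auto
  qed
  have "col u \<noteq> col v" if uv: "u \<in> V" "v \<in> V" "E u v" for u v
  proof
    assume "col u = col v"
    then consider "(map (E u) xs, map (E v) xs) \<in> set (same_pairs coloured)"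
      | "(map (E v) xs, map (E u) xs) \<in> set (same_pairs coloured)"
      using same_pairs_complete[OF col[OF uv(1)], of "map (E v) xs"] col[OF uv(2)] by auto
    then show False
      using joinable_pairs_complete[OF assms(1,2) copy, of _ _ "same_pairs coloured" ws] assms(3)
        uv sym[OF uv(3)]
      unfolding coloured_def by cases (auto simp: Let_def)
  qed
  moreover have "col ` V \<subseteq> {..<k}"
    using col assms(3) by (fastforce simp: list_all_iff coloured_def Let_def dest: set_zip_rightD)
  ultimately show False using not_colorable unfolding colorable_def by blast
qed

lemma copy_fold_refuted:
  assumes "avoids E V (map fst B)" "avoids E V P" "refutes k B P hs J (Fold a b)"
  shows "\<not> copy E V xs J"
proof
  assume copy: "copy E V xs J"
  have J: "length xs = length J" "set xs \<subseteq> V" using copy_length[OF copy] copy_in[OF copy] .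
  have "xs ! a \<noteq> xs ! b"
    using assms(3) adj_copy[OF copy] by auto
  moreover have ab: "a < length xs" "b < length xs" using assms(3) J by auto
  ultimately obtain v where v: "v \<in> V" "E v (xs ! a)" "\<not> E v (xs ! b)"
    using not_dominated[of "xs ! a" "xs ! b"] J nth_mem by blast
  then show False
    using labelled_types_complete[OF assms(1,2) copy v(1), of "[a, b]" "[True, False]" hs] assms(3) ab by auto
qed

lemma refutes_all_sound:
  "avoids E V (map fst B) \<Longrightarrow> avoids E V P \<Longrightarrow> refutes_all k B P ss \<Longrightarrow> avoids E V (P @ map (rows_of \<circ> fst) ss)"
proof (induction ss arbitrary: P)
  case (Cons s ss)
  obtain ns hs r where s: "s = (ns, hs, r)" by (cases s)
  have refuted: "refutes k B P hs (rows_of ns) r" "refutes_all k B (P @ [rows_of ns]) ss"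
    using Cons.prems(3) by (auto simp: s split: if_splits)
  have "\<not> contains E V (rows_of ns)"
    unfolding contains_def
    using refuted(1) copy_colour_refuted[OF Cons.prems(1,2)] copy_fold_refuted[OF Cons.prems(1,2)]
    by (cases r) blast+
  then show ?case
    using Cons.IH[OF Cons.prems(1) _ refuted(2)] Cons.prems(2) by (simp add: s)
qed simp

end

lemma (in simple_graph) ex_critical_subgraph:
  assumes "finite V" "\<not> colorable E V k"
  obtains W where "W \<subseteq> V" "critical_graph E W k"
proof -
  obtain W where W: "W \<subseteq> V" "\<not> colorable E W k"
    and least: "\<And>U. U \<subseteq> V \<Longrightarrow> \<not> colorable E U k \<Longrightarrow> card W \<le> card U"
    using ex_has_least_nat[of "\<lambda>W. W \<subseteq> V \<and> \<not> colorable E W k" V card] assms(2) by auto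
  have "finite W" using W(1) assms(1) finite_subset by blast
  moreover have "colorable E U k" if "U \<subset> W" for U
    using least[of U] psubset_card_mono[OF \<open>finite W\<close> that] W(1) that by fastforce
  ultimately have "critical_graph E W k"
    using W(2) by unfold_locales (simp_all add: sym irrefl)
  then show thesis using that W(1) by blast
qed


section \<open>Graphs without 2K2 and K4\<close>

definition base_2K2_K4 :: "(rows \<times> rows) list" where
  "base_2K2_K4 = [(matching_rows 2, rows_of [[],[],[3],[]]), (clique_rows 4, rows_of [[],[2],[3],[]])]"

lemma fst_base_2K2_K4: "map fst base_2K2_K4 = [matching_rows 2, clique_rows 4]"
  by (simp add: base_2K2_K4_def)

text \<open>
  The certificates were found by computer search. The last three patterns of the following one are a
  pentagon together with a vertex that is adjacent to all, to four, and to none of its vertices.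
\<close>

definition certificate_C5 :: "(nat list list \<times> (nat \<times> nat list) list \<times> reason) list" where
  "certificate_C5 = [
   ([[1,2,4,6,7,8],[3,5,6,7,8],[3,5,6,7],[4,5,8],[5,6],[6,7],[],[],[]], [], Fold 7 6),
   ([[2,3,5,6,7,8],[4,5,7,8],[3,4,5],[4,7,8],[5,6,8],[6,7],[8],[],[]],
    [],
    Colour [0,0,1,1,1,0,2,0,2,0,1,1,1,2,3,3,3,3,2,3,2] [(2,[9,7,0,6,5,4,2,1,3])]),
   ([[2,4,8],[3,4,6,7,8],[3,4,5,6,7],[4,5,6,8],[7],[7,8],[],[8],[]],
    [(3,[8,7,9,6,4,2,5,0,3])],
    Fold 6 4),
   ([[2,4,7,8],[2,3,4,5,8],[3,5,6,7],[7,8],[5,6,7,8],[6,7],[8],[],[]],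
    [(3,[2,1,0,4,8,5,6,9,3]), (4,[4,6,9,5,2,1,7,0,8]), (3,[5,4,7,6,0,9,1,2,8])],
    Colour [0,0,3,0,3,3,3,2,2,1,2,0,0,0,1,1,1,2,2,1,2,2] []),
   ([[2,3,5,6,7],[2,3,5,7],[3,4,7],[6],[5,6,7],[6,7],[],[]],
    [(5,[0,1,6,7,3,8,2,5,4]), (5,[0,1,3,4,6,8,5,2,7])],
    Colour [1,1,1,1,1,1,2,2,2,1,1,1,2,2,2,0,0,3,3,3,3,3,0,0] [(4,[0,8,4,2,1,9,5,6,7]),
       (5,[8,1,6,0,2,9,4,7,5]), (5,[4,0,6,1,2,7,8,9,5]), (2,[8,2,6,4,0,9,1,7,5])]),
   ([[2,4,5],[2,3,5,6],[4,5,6,7],[4,5,7],[6,7],[7],[],[]],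
    [(6,[3,4,8,5,0,2,7,6]), (6,[3,0,5,7,4,6,2,8]), (3,[5,2,1,0,6,3,8,7,4]), (2,[5,3,0,2,4,6,8,1,7])],
    Colour [0,0,0,1,3,2,3,1,3,3,0,0,2,2,2,1,1,1,0,2,0,0,1,1] [(6,[1,6,4,8,7,5,0,9]),
       (6,[0,9,5,1,3,4,8,7]), (6,[9,2,4,6,3,1,5,0]), (6,[4,1,0,8,5,7,3,9]), (2,[6,1,4,3,5,7,9,2,0]),
       (4,[1,6,3,4,0,7,8,5,9])]),
   ([[4,5,6],[2,4,5,6],[4,6,7],[5,6,7],[5,7],[7],[],[]],
    [(6,[0,6,8,4,3,2,7,5]), (7,[1,8,6,3,0,5,4,2]), (6,[0,8,6,4,2,3,7,5]), (6,[2,1,0,7,8,5,3,6])],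
    Colour [0,3,1,3,0,0,0,0,1,3,1,2,1,1,1,2,2,2,2] [(6,[9,3,6,7,0,1,5,4])]),
   ([[1,2,7],[2,3,6],[3,4,5,6],[4,5,7],[6,7],[],[],[]],
    [(7,[6,5,4,7,0,3,8,2]), (8,[1,4,5,0,3,2,8,7])],
    Fold 5 4),
   ([[1,5,6],[3,7],[3,5,6,7],[4,5,6],[5],[7],[],[]],
    [(9,[2,0,4,3,6,7,5,8]), (9,[1,0,6,3,4,8,5,7]), (9,[2,0,4,6,3,5,7,8]), (9,[2,1,0,6,3,5,7,8]),
     (9,[1,2,0,4,3,5,8,7]), (9,[1,0,6,4,3,5,8,7])],
    Colour [0,0,0,3,0,1,0,1,1,1,0,3,3,3,3,3,2,2,2,2,2,2] [(9,[0,1,4,5,7,8,9,6]), (9,[2,0,1,4,5,9,6,8]),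
       (9,[3,0,1,7,4,6,8,9]), (9,[9,1,0,8,5,2,6,4])]),
   ([[1,3,4,6],[2,4,5,6],[3,4,5],[5,6],[],[6],[]],
    [(7,[0,3,2,4,1,6,5,7]), (7,[0,1,2,4,3,7,5,6]), (6,[2,4,6,3,0,1,5,7]), (6,[2,4,7,1,0,3,5,6])],
    Colour [1,3,3,3,1,3,0,3,1,1,1,1,0,3,2,2,2,2,0,0,0] [(9,[4,7,5,1,2,0,8,6]), (7,[6,7,3,1,2,4,8,0]),
       (7,[6,8,3,1,4,2,7,0]), (7,[0,4,1,5,2,7,6,8]), (7,[0,2,1,5,4,8,6,7])]),
   ([[1,2,6],[3,4,5],[3,4,6],[4],[5,6],[6],[]],
    [(11,[2,5,7,1,6,3,0]), (11,[6,5,3,0,7,4,2]), (11,[7,5,2,0,6,4,3]), (11,[2,5,3,1,4,7,0]),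
     (11,[3,5,2,0,4,6,7]), (11,[5,7,1,2,3,0,6]), (11,[6,5,4,0,2,3,7])],
    Colour [1,2,1,1,2,2,2,0,3,3,3,3,0,2,1,0,1,1,1,0,0] [(11,[3,6,8,1,7,4,0]), (11,[7,1,5,6,0,4,8]),
       (11,[0,4,8,7,2,6,1]), (11,[2,4,6,1,8,5,0]), (11,[3,1,8,6,0,4,5])]),
   ([[2,3,4,6],[3,4,5,6],[4,5],[5],[5],[],[]],
    [(11,[1,0,2,5,7,6,3]), (12,[1,4,5,2,6,0,3]), (11,[4,6,5,1,2,3,0]), (8,[4,5,3,7,6,2,1,0])],
    Fold 6 4),
   ([[2],[2,5,6],[3,4,6],[4,5],[6],[],[]], [(13,[4,2,5,0,3,7,6]), (9,[2,7,3,0,4,1,5,6])], Fold 0 4),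
   ([[1,2,3,6],[2,4],[5],[4,5],[],[],[]],
    [(14,[7,5,0,6,3,4,2]), (10,[4,6,2,0,7,1,5,3]), (10,[5,4,3,1,7,0,2,6])],
    Fold 6 3),
   ([[1,2,3,4,5],[3,5],[4,5],[4],[],[]],
    [(12,[0,3,2,6,1,5,4]), (12,[0,2,5,4,1,6,3]), (11,[3,1,2,0,6,4,5]), (12,[0,4,3,5,1,2,6]),
     (11,[4,1,3,0,5,6,2]), (12,[0,5,2,4,1,3,6]), (11,[2,1,5,0,4,3,6]), (12,[0,6,4,2,1,3,5]),
     (11,[5,1,6,0,3,2,4]), (11,[6,1,4,0,2,5,3])],
    Colour [1,1,1,1,0,1,3,3,0,2,2,2,0] [(12,[0,3,1,5,2,7,4]), (11,[4,1,5,2,0,3,7]),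
       (11,[5,1,7,2,0,4,6]), (12,[1,6,0,5,2,4,7])]),
   ([[2,3,4],[3,4,5],[3,5],[5],[],[]],
    [(16,[4,0,3,2,6,1]), (16,[0,5,3,2,6,1]), (13,[2,1,6,0,4,3,5]), (14,[0,1,4,2,6,5,3]),
     (13,[1,2,3,0,4,6,5])],
    Colour [2,2,3,0,0,0,2,3,1,3,3,3,1,1] [(13,[3,2,0,5,1,4,6]), (13,[3,1,5,0,7,4,6])]),
   ([[1,2],[3],[4],[4],[],[]],
    [(17,[2,3,4,0,1,5]), (15,[0,4,2,3,5,1,6]), (15,[0,5,3,2,4,1,6])],
    Fold 5 0)]"

definition patterns_C5 :: "rows list" where
  "patterns_C5 = map fst base_2K2_K4 @ map (rows_of \<circ> fst) certificate_C5"

lemma refutes_all_certificate_C5: "refutes_all 4 base_2K2_K4 (map fst base_2K2_K4) certificate_C5"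
  by code_simp

lemma (in critical_graph) avoids_patterns_C5:
  assumes "k = 4" "avoids E V (map fst base_2K2_K4)"
  shows "avoids E V patterns_C5"
  unfolding patterns_C5_def using refutes_all_sound[OF assms(2,2)] refutes_all_certificate_C5 assms(1) by blast

text \<open>
  The types of vertices that remain around a pentagon, in circular order. Vertices in equal or
  consecutive blocks are not adjacent, and vertices in blocks at distance 4 are adjacent.
\<close>

definition blocks :: "bool list list" where
  "blocks = map (\<lambda>js. map (\<lambda>j. j \<in> set js) [0..<5])
     [[1,4], [1,3,4], [1,3], [0,1,3], [0,3], [0,2,3], [0,2], [0,2,4], [2,4], [1,2,4]]"

definition near_blocks :: "(bool list \<times> bool list) list" where
  "near_blocks = map (\<lambda>i. (blocks ! i, blocks ! i)) [0..<10] @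
     map (\<lambda>i. (blocks ! i, blocks ! (Suc i mod 10))) [0..<10]"

lemma length_blocks: "length blocks = 10"
  by (simp add: blocks_def)

lemma nth_blocks:
  "blocks ! 0 = [False, True, False, False, True]" "blocks ! 2 = [False, True, False, True, False]"
  "blocks ! 3 = [True, True, False, True, False]"
  by code_simp+

lemma possible_types_C5_subset_blocks:
  "list_all (\<lambda>t. t \<in> set blocks) (possible_types base_2K2_K4 patterns_C5
     [(18,[1,5,2,4,3,0]), (17,[4,1,3,0,5,2]), (17,[3,5,2,0,4,1]), (17,[4,2,5,0,3,1]), (17,[3,1,4,0,2,5]),
      (17,[5,2,4,0,1,3]), (16,[0,3,1,4,5,2])] C5)"
  by code_simp

lemma near_blocks_not_joinable:
  "joinable_pairs base_2K2_K4 patterns_C5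
     [(17,[5,3,6,1,4,0]), (17,[3,6,1,0,2,5]), (17,[2,5,3,1,6,0]), (17,[3,5,2,0,4,1]), (17,[4,2,5,1,3,0]),
      (17,[2,5,1,0,6,4]), (17,[4,6,0,1,5,2]), (17,[4,2,1,0,3,6]), (17,[3,6,4,1,2,0]), (17,[6,4,1,0,5,3])]
     C5 near_blocks = []"
  by code_simp

lemma far_blocks_crossing:
  "\<forall>i\<in>{..<10}. \<exists>a\<in>{..<5}. \<exists>b\<in>{..<5}. \<not> adj C5 a b \<and> blocks ! i ! a \<and> \<not> blocks ! ((i + 4) mod 10) ! a \<and>
     blocks ! ((i + 4) mod 10) ! b \<and> \<not> blocks ! i ! b"
  by code_simp

context simple_graph
begin

definition block :: "'a list \<Rightarrow> nat \<Rightarrow> 'a set" where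
  "block xs i = {v \<in> V. map (E v) xs = blocks ! i}"

lemma in_block_ex:
  assumes "avoids E V patterns_C5" "copy E V xs C5" "v \<in> V"
  shows "\<exists>i<10. v \<in> block xs i"
proof -
  have "avoids E V (map fst base_2K2_K4)" using assms(1) by (simp add: patterns_C5_def)
  then have "map (E v) xs \<in> set blocks"
    using possible_types_complete[OF _ assms] possible_types_C5_subset_blocks unfolding list_all_iff by blast
  then show ?thesis using assms(3) length_blocks unfolding block_def by (auto simp: in_set_conv_nth)
qed

lemma near_blocks_not_adjacent:
  assumes "avoids E V patterns_C5" "copy E V xs C5" "i < 10" "j = i \<or> j = Suc i mod 10"
    and uv: "u \<in> block xs i" "v \<in> block xs j"
  shows "\<not> E u v"
proof
  assume "E u v"
  have "u \<in> V" "v \<in> V" using uv by (simp_all add: block_def)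
  have "avoids E V (map fst base_2K2_K4)" using assms(1) by (simp add: patterns_C5_def)
  moreover have "(map (E u) xs, map (E v) xs) \<in> set near_blocks"
    using assms(3-6) by (auto simp: near_blocks_def block_def)
  ultimately show False
    by (metis joinable_pairs_complete[OF _ assms(1,2) \<open>u \<in> V\<close> \<open>v \<in> V\<close> \<open>E u v\<close>] near_blocks_not_joinable
        empty_set emptyE)
qed

lemma far_blocks_adjacent:
  assumes "avoids E V patterns_C5" "copy E V xs C5" "i < 10" "j = (i + 4) mod 10"
    and uv: "u \<in> block xs i" "v \<in> block xs j"
  shows "E u v"
proof -
  obtain a b where ab: "a < 5" "b < 5" "\<not> adj C5 a b"
    "blocks ! i ! a" "\<not> blocks ! j ! a" "blocks ! j ! b" "\<not> blocks ! i ! b"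
    using far_blocks_crossing assms(3,4) by blast
  have xs: "length xs = 5" "set xs \<subseteq> V"
    using copy_length[OF assms(2)] copy_in[OF assms(2)] by (simp_all add: C5_rows)
  have "map (E u) xs = blocks ! i" "map (E v) xs = blocks ! j" using uv by (simp_all add: block_def)
  then have "E u (xs ! a)" "\<not> E v (xs ! a)" "E v (xs ! b)" "\<not> E u (xs ! b)"
    using ab xs(1) by (metis nth_map)+
  moreover have "\<not> E (xs ! a) (xs ! b)"
    using ab adj_copy[OF assms(2), of a b] by (simp add: C5_rows)
  moreover have "{u, xs ! a, v, xs ! b} \<subseteq> V"
    using uv ab(1,2) xs nth_mem by (auto simp: block_def)
  moreover have "\<not> contains E V (matching_rows 2)"
    using assms(1) by (simp add: patterns_C5_def fst_base_2K2_K4)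
  ultimately show ?thesis
    using edges_joined_if_2K2_free[of u "xs ! a" v "xs ! b"] comm by blast
qed

text \<open>The circle of blocks is cut greedily into four arcs without inner edges.\<close>

lemma colorable_4_if_circular_blocks:
  fixes blk :: "'a \<Rightarrow> nat"
  assumes range: "\<And>v. v \<in> V \<Longrightarrow> blk v < 10"
    and near: "\<And>u v. u \<in> V \<Longrightarrow> v \<in> V \<Longrightarrow> E u v \<Longrightarrow> blk v \<noteq> blk u \<and> blk v \<noteq> Suc (blk u) mod 10"
    and far: "\<And>u v. u \<in> V \<Longrightarrow> v \<in> V \<Longrightarrow> blk v = (blk u + 4) mod 10 \<Longrightarrow> E u v"
    and blocks_0_2: "\<And>u v. u \<in> V \<Longrightarrow> v \<in> V \<Longrightarrow> blk u = 0 \<Longrightarrow> blk v = 2 \<Longrightarrow> \<not> E u v"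
    and no_K4: "\<not> contains E V (clique_rows 4)"
  shows "colorable E V 4"
proof -
  define B5 where "B5 v \<longleftrightarrow> (\<exists>y\<in>V. blk y = 3 \<and> E y v)" for v
  define B7 where "B7 v \<longleftrightarrow> (\<exists>z\<in>V. blk z = 5 \<and> B5 z \<and> E z v)" for v
  define col :: "'a \<Rightarrow> nat" where "col v =
    (if blk v \<le> 2 then 0
     else if blk v \<le> 4 \<or> blk v = 5 \<and> \<not> B5 v then 1
     else if blk v \<le> 6 \<or> blk v = 7 \<and> \<not> B7 v then 2 else 3)" for v
  have B7_no_9: "\<not> E u v" if uv: "u \<in> V" "v \<in> V" "blk u = 7" "blk v = 9" "B7 u" for u v
  proof
    assume "E u v"
    obtain z y where zy: "z \<in> V" "blk z = 5" "E z u" "y \<in> V" "blk y = 3" "E y z"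
      using uv(5) unfolding B7_def B5_def by blast
    then have "sorted_wrt E [y, z, u, v]"
      using far[of y u] far[of v y] far[of z v] uv \<open>E u v\<close> sym by auto
    then show False using no_clique[OF no_K4, of "[y, z, u, v]"] uv(1,2) zy(1,4) by simp
  qed
  have proper: "col u \<noteq> col v" if uv: "u \<in> V" "v \<in> V" "E u v" "blk u \<le> blk v" for u v
  proof
    assume eq: "col u = col v"
    have "blk v \<noteq> blk u" "blk v \<noteq> Suc (blk u)"
      using near[OF uv(1-3)] range[OF uv(1)] range[OF uv(2)] by (auto simp: mod_Suc)
    then consider "blk u = 0" "blk v = 2" | "blk u = 3" "blk v = 5" "\<not> B5 v"
      | "blk u = 5" "blk v = 7" "B5 u" "\<not> B7 v" | "blk u = 7" "blk v = 9" "B7 u"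
      using range[OF uv(1)] range[OF uv(2)] uv(4) eq unfolding col_def by (auto split: if_splits)
    then show False
      using blocks_0_2 B7_no_9 uv unfolding B5_def B7_def by cases blast+
  qed
  have "col u \<noteq> col v" if "u \<in> V" "v \<in> V" "E u v" for u v
    using proper[OF that] proper[OF that(2,1) sym[OF that(3)]] by (metis nle_le)
  moreover have "col ` V \<subseteq> {..<4}" by (auto simp: col_def)
  ultimately show ?thesis unfolding colorable_def by blast
qed

lemma exchange_enlarges_block_3:
  assumes "avoids E V patterns_C5" "copy E V (y # cs) C5"
    and u: "u \<in> block (y # cs) 0" and w: "w \<in> block (y # cs) 2" and "E u w"
  shows "copy E V (u # cs) C5" "block (y # cs) 3 \<subset> block (u # cs) 3"
proof -
  have V: "u \<in> V" "w \<in> V" "y \<in> V" using u w copy_in[OF assms(2)] by (simp_all add: block_def)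
  have u_type: "\<not> E u y" "map (E u) cs = [True, False, False, True]"
    and w_type: "\<not> E w y" "map (E w) cs = [True, False, True, False]"
    using u w by (simp_all add: block_def nth_blocks)
  show "copy E V (u # cs) C5" using assms(2) u_type V(1) by (simp add: C5_rows split: if_splits)
  have "block (y # cs) 3 \<subseteq> block (u # cs) 3"
  proof
    fix v assume v: "v \<in> block (y # cs) 3"
    then have v_type: "v \<in> V" "E v y" "map (E v) cs = [True, False, True, False]"
      by (simp_all add: block_def nth_blocks)
    have "\<not> E w v" using near_blocks_not_adjacent[OF assms(1,2) _ _ w v] by simp
    moreover have "\<not> contains E V (matching_rows 2)"
      using assms(1) by (simp add: patterns_C5_def fst_base_2K2_K4)
    ultimately have "E v u"
      using edges_joined_if_2K2_free[of v y u w] u_type(1) w_type(1) v_type(1,2) V comm \<open>E u w\<close> by auto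
    then show "v \<in> block (u # cs) 3" using v_type by (simp add: block_def nth_blocks)
  qed
  moreover have "w \<in> block (u # cs) 3 - block (y # cs) 3"
    using w_type V(2) \<open>E u w\<close> sym by (simp add: block_def nth_blocks)
  ultimately show "block (y # cs) 3 \<subset> block (u # cs) 3" by blast
qed

lemma ex_pentagon_separating_blocks:
  assumes "finite V" "avoids E V patterns_C5" "contains E V C5"
  obtains xs where "copy E V xs C5" "\<And>u w. u \<in> block xs 0 \<Longrightarrow> w \<in> block xs 2 \<Longrightarrow> \<not> E u w"
proof -
  obtain x cs where x: "copy E V (x # cs) C5"
    using assms(3) unfolding contains_def C5_rows by (metis copy.simps(4) neq_Nil_conv)
  have finite_block: "finite (block xs i)" for xs i
    using assms(1) by (simp add: block_def)
  have "card (block (y # cs) 3) < Suc (card V)" for y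
    using card_mono[OF assms(1), of "block (y # cs) 3"] by (auto simp: block_def)
  then obtain y where y: "copy E V (y # cs) C5"
    and greatest: "\<And>z. copy E V (z # cs) C5 \<Longrightarrow> card (block (z # cs) 3) \<le> card (block (y # cs) 3)"
    using ex_has_greatest_nat[of "\<lambda>y. copy E V (y # cs) C5" x "\<lambda>y. card (block (y # cs) 3)"] x by blast
  have "\<not> E u w" if "u \<in> block (y # cs) 0" "w \<in> block (y # cs) 2" for u w
    using exchange_enlarges_block_3[OF assms(2) y that] greatest psubset_card_mono[OF finite_block]
    by (metis not_less)
  then show thesis using that y by blast
qed

lemma colorable_4_if_contains_C5:
  assumes "finite V" "avoids E V patterns_C5" "contains E V C5"
  shows "colorable E V 4"
proof -
  obtain xs where xs: "copy E V xs C5"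
    and separated: "\<And>u w. u \<in> block xs 0 \<Longrightarrow> w \<in> block xs 2 \<Longrightarrow> \<not> E u w"
    using ex_pentagon_separating_blocks[OF assms] by blast
  obtain blk where blk: "\<And>v. v \<in> V \<Longrightarrow> blk v < 10" "\<And>v. v \<in> V \<Longrightarrow> v \<in> block xs (blk v)"
    using in_block_ex[OF assms(2) xs] by metis
  show ?thesis
  proof (rule colorable_4_if_circular_blocks)
    show "blk v \<noteq> blk u \<and> blk v \<noteq> Suc (blk u) mod 10" if "u \<in> V" "v \<in> V" "E u v" for u v
      using near_blocks_not_adjacent[OF assms(2) xs blk(1)[OF that(1)] _ blk(2)[OF that(1)]] blk(2) that
      by metis
    show "E u v" if "u \<in> V" "v \<in> V" "blk v = (blk u + 4) mod 10" for u v
      by (rule far_blocks_adjacent[OF assms(2) xs blk(1)[OF that(1)] that(3)]) (use blk(2) that(1,2) in auto)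
    show "\<not> E u v" if "u \<in> V" "v \<in> V" "blk u = 0" "blk v = 2" for u v
      using separated blk(2) that by metis
    show "\<not> contains E V (clique_rows 4)" using assms(2) by (simp add: patterns_C5_def fst_base_2K2_K4)
  qed (rule blk(1))
qed

end

definition certificate_K3 :: "(nat list list \<times> (nat \<times> nat list) list \<times> reason) list" where
  "certificate_K3 = [
   ([[3,4,5,6],[3,6,8],[3,4,6,8],[4,5,7],[7,8],[6,8],[7,8],[],[]],
    [],
    Colour [0,1,3,3,3,3,0,3,1,2,1,2,2,2,0,2] []),
   ([[2,3,4,6],[2,3,4,5],[4,5,7],[5,6,7],[6,7],[6],[],[]],
    [(3,[1,0,2,5,3,7,4,8,6]), (3,[2,0,1,3,5,6,4,8,7])],
    Colour [0,1,2,1,3,1,2,0,2,3,3,3,0] []),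
   ([[1,2],[3,4,5],[3,4,5,6],[4,6],[],[6],[]], [(4,[6,5,2,3,0,4,7,1])], Fold 5 3),
   ([[3,4],[2,3,4,5],[3],[5],[5],[]], [(5,[1,5,4,2,6,0,3])], Fold 2 5),
   ([[1,2,3],[2,4],[],[4],[]],
    [(6,[5,1,3,2,4,0]), (6,[4,2,3,1,5,0])],
    Colour [2,2,2,2,1,1,0,0,3,3,3,3] [(6,[6,1,4,3,5,0]), (6,[5,1,4,2,6,0])]),
   ([[1,2],[2],[]], [], Colour [3,3,3,0,3,1,2] [(7,[2,3,4,0,1]), (7,[2,4,3,0,1]), (7,[3,4,2,0,1])])]"

definition base_2K2_K4_C5 :: "(rows \<times> rows) list" where
  "base_2K2_K4_C5 = base_2K2_K4 @ [(C5, rows_of [[],[4],[],[],[]])]"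

lemma refutes_all_certificate_K3: "refutes_all 4 base_2K2_K4_C5 (map fst base_2K2_K4_C5) certificate_K3"
  by code_simp

lemma clique_3_in_certificate_K3: "clique_rows 3 \<in> set (map (rows_of \<circ> fst) certificate_K3)"
  by code_simp

lemma (in critical_graph) not_contains_triangle:
  assumes "k = 4" "avoids E V (map fst base_2K2_K4_C5)"
  shows "\<not> contains E V (clique_rows 3)"
proof -
  have "avoids E V (map fst base_2K2_K4_C5 @ map (rows_of \<circ> fst) certificate_K3)"
    using refutes_all_sound[OF assms(2,2)] refutes_all_certificate_K3 assms(1) by blast
  then show ?thesis using clique_3_in_certificate_K3 unfolding avoids_def by auto
qed

theorem (in simple_graph) colorable_4_if_2K2_K4_free:
  assumes "finite V" "\<not> contains E V (matching_rows 2)" "\<not> contains E V (clique_rows 4)"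
  shows "colorable E V 4"
proof (rule ccontr)
  assume "\<not> colorable E V 4"
  from ex_critical_subgraph[OF assms(1) this] obtain W where W: "W \<subseteq> V" "critical_graph E W 4" by blast
  interpret W: critical_graph E W 4 by (rule W(2))
  have free: "avoids E W (map fst base_2K2_K4)"
    using assms(2,3) contains_mono[OF _ W(1)] by (auto simp: fst_base_2K2_K4)
  then have C5: "\<not> contains E W C5"
    using W.colorable_4_if_contains_C5[OF W.finite W.avoids_patterns_C5] W.not_colorable by blast
  then have "\<not> contains E W (clique_rows 3)"
    using W.not_contains_triangle free by (simp add: base_2K2_K4_C5_def)
  moreover have "\<not> colorable E W 2" using W.not_colorable colorable_mono by fastforce
  moreover then obtain a b where "a \<in> W" "b \<in> W" "E a b" by (rule ex_edge_if_not_colorable) simp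
  moreover have "\<not> contains E W (matching_rows 2)" using free by (simp add: fst_base_2K2_K4)
  ultimately obtain v z u where "copy E W [a, b, v, z, u] C5"
    using W.ex_pentagon_through_edge by blast
  then show False using C5 unfolding contains_def by blast
qed


section \<open>Graphs without 3K2 and K3\<close>

definition base_3K2_K3 :: "(rows \<times> rows) list" where
  "base_3K2_K3 = [(clique_rows 3, rows_of [[],[2],[]]), (matching_rows 3, rows_of [[],[],[3,4],[],[5],[]])]"

lemma fst_base_3K2_K3: "map fst base_3K2_K3 = [clique_rows 3, matching_rows 3]"
  by (simp add: base_3K2_K3_def)

definition certificate_3K2 :: "(nat list list \<times> (nat \<times> nat list) list \<times> reason) list" where
  "certificate_3K2 = [
   ([[1,2],[3,7],[4,7],[4],[],[6,9],[7],[8],[9],[]],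
    [],
    Colour [0,0,2,3,2,2,3,3,2,3,2,2,3,0,0,0,0,2,2,2,3,3,3,0,0,0,0,1,1,1,1,1,1,1,1,1,1,1,1,1,1,1,1,1] []),
   ([[1,2],[3,5],[4,5,7],[4],[],[6,9],[7],[8],[9],[]],
    [(2,[7,6,8,10,9,4,5,3,1,0]), (2,[1,0,2,5,4,9,10,6,7,8]), (2,[1,2,3,4,5,9,10,6,7,0]),
     (2,[7,0,8,10,9,4,5,3,1,2])],
    Colour [1,0,1,0,1,1,2,0,2,1,2,1,3,1,3,0,3,1,3,3,0,3,0,3,3,3,3,3,0,1,0,0,0,1,1,1,0,2,0,2,2,2,2,0] []),
   ([[1,2],[3,5],[4,7],[4],[],[6,9],[7],[8],[9],[]],
    [(2,[1,0,2,5,4,9,10,6,7,8]), (2,[1,3,0,5,4,10,9,8,7,6]), (3,[1,3,0,5,4,8,7,6,10,9]),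
     (3,[1,2,0,4,5,6,7,8,9,10]), (3,[10,9,6,8,7,0,1,2,4,5]), (2,[7,0,6,9,10,5,4,2,1,3]),
     (3,[1,3,2,5,4,0,7,6,10,9]), (3,[7,6,0,10,9,2,4,5,3,1]), (2,[7,0,8,10,9,4,5,3,1,2]),
     (3,[1,2,3,4,5,0,7,8,9,10]), (3,[7,8,0,9,10,3,5,4,2,1]), (3,[1,3,0,5,4,8,9,10,6,7])],
    Colour [0,0,0,1,2,0,1,1,0,2,2,0,0,2,2,0,3,2,3,2,2,1,3,2,2,1,1,1,1,1,1] []),
   ([[1,2],[3],[4],[4],[],[6,9],[7],[8],[9],[]],
    [(2,[1,2,3,4,5,10,6,0,8,9]), (2,[7,6,8,10,9,5,4,0,1,3]), (2,[5,4,3,2,1,10,6,0,8,9]),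
     (2,[7,6,8,10,9,4,5,0,1,2]), (2,[7,6,8,10,9,1,2,0,5,3]), (2,[10,9,6,8,7,4,2,0,3,5]),
     (2,[10,6,9,7,8,5,4,0,1,3]), (2,[5,3,4,1,2,7,6,0,9,8]), (2,[3,1,5,2,4,8,9,0,6,7]),
     (2,[4,5,2,3,1,8,9,0,6,7]), (2,[1,2,3,4,5,6,7,0,9,10]), (2,[2,4,1,5,3,10,9,0,7,6]),
     (2,[5,4,3,2,1,10,9,0,7,6]), (2,[8,9,7,10,6,2,1,0,5,4]), (2,[8,9,7,10,6,3,5,0,2,1]),
     (2,[6,7,10,8,9,4,2,0,3,5]), (2,[6,10,7,9,8,3,1,0,4,5]), (2,[6,7,10,8,9,2,4,0,3,1]),
     (2,[6,10,7,9,8,2,1,0,5,4]), (2,[6,10,7,9,8,1,2,0,5,3]), (2,[9,10,8,6,7,5,3,0,2,4]),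
     (2,[9,10,8,6,7,5,4,0,1,3]), (2,[5,3,4,1,2,6,10,0,8,7]), (2,[3,5,1,4,2,6,10,0,8,7]),
     (2,[4,5,2,3,1,6,10,0,8,7])],
    Colour [0,0,1,0,1,2,0,0,1,1,2] []),
   ([[1,4,9],[2,3],[4,6,8],[5,6,8],[5],[],[7,10],[8],[9],[10],[]],
    [(4,[11,10,7,0,8,1,2,4,6,5]), (3,[8,0,9,11,10,4,2,3,5,6]), (2,[8,7,9,11,10,5,6,4,2,0]),
     (3,[2,0,4,5,6,7,8,9,10,11]), (4,[2,0,1,6,5,7,11,10,9,8]), (3,[2,0,4,5,6,9,8,7,11,10]),
     (2,[2,1,0,5,6,8,9,10,11,7]), (3,[11,7,10,8,9,0,2,1,5,6]), (3,[8,0,7,10,11,4,2,3,5,6]),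
     (3,[2,1,0,5,6,10,9,8,7,11]), (2,[2,3,4,5,6,11,10,9,8,0]), (3,[8,0,9,11,10,3,2,4,6,5]),
     (2,[8,7,9,11,0,1,2,4,6,5])],
    Colour [2,0,3,0,1,0,2,2,2,2,1,1,1,1,1,1,1,1,1,1,3,0,0,0,0,3,0,0,0,2,2,0] []),
   ([[1,5,6,9],[2,3],[4,6,8],[5,6,8],[5],[],[7,10],[8],[9],[10],[]],
    [(3,[2,3,1,5,6,7,11,10,0,8]), (3,[8,0,9,11,10,3,2,4,6,5]), (2,[8,7,9,11,10,5,6,4,2,0]),
     (2,[8,7,9,11,10,6,5,3,2,0]), (3,[2,0,1,5,6,7,11,10,9,8]), (3,[2,0,3,6,5,7,8,9,10,11]),
     (3,[2,0,4,5,6,9,8,7,11,10]), (3,[2,0,3,6,5,9,8,7,11,10]), (3,[2,0,1,5,6,10,11,7,8,9]),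
     (3,[8,0,7,10,11,3,2,4,6,5]), (2,[2,3,4,5,6,11,10,9,8,0]), (3,[8,0,9,11,10,4,2,3,5,6]),
     (3,[2,1,3,6,5,7,8,9,0,11]), (6,[0,2,4,3,6,5,7,8,9,10,11]), (6,[0,8,9,7,10,11,4,2,3,5,6]),
     (6,[0,8,9,7,10,11,3,2,4,6,5]), (6,[0,2,4,3,6,5,9,8,7,11,10]), (6,[1,2,4,3,6,5,0,8,9,10,11]),
     (6,[0,8,7,9,11,10,4,2,3,5,6])],
    Colour [3,0,0,0,0,2,1,1,1,2,2,3,3,2,2,2,3,3,2,2,0,0,0,0,2,0,1,1,1,1,1]
       [(6,[1,0,4,5,6,7,10,9,8,12,11])]),
   ([[1,2],[3,5,7],[4,5,7],[4],[],[6,9],[7],[8],[9],[]],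
    [(2,[7,6,8,10,9,4,5,3,1,0]), (2,[7,8,6,9,10,0,1,2,4,5]), (3,[1,0,3,4,5,6,7,8,9,10]),
     (3,[7,8,6,9,10,2,1,0,5,4]), (3,[7,6,8,10,9,3,1,0,4,5]), (3,[7,6,8,10,9,2,1,0,5,4]),
     (2,[1,2,3,4,5,9,10,6,7,0]), (3,[7,0,6,9,10,2,1,3,5,4]), (3,[7,0,6,9,10,3,1,2,4,5]),
     (2,[1,2,3,4,5,10,9,8,7,0]), (3,[7,0,8,10,9,2,1,3,5,4]), (3,[7,0,8,10,9,3,1,2,4,5]),
     (6,[0,1,2,3,4,5,6,7,8,9,10]), (6,[0,1,3,2,5,4,6,7,8,9,10]), (7,[0,1,3,2,5,4,6,7,8,9,10]),
     (7,[0,1,2,3,4,5,6,7,8,9,10]), (6,[0,7,8,6,9,10,3,1,2,4,5]), (7,[0,7,6,8,10,9,3,1,2,4,5]),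
     (6,[0,7,8,6,9,10,2,1,3,5,4]), (7,[0,7,6,8,10,9,2,1,3,5,4]), (6,[0,1,2,3,4,5,8,7,6,10,9]),
     (6,[0,1,3,2,5,4,8,7,6,10,9]), (6,[0,7,6,8,10,9,3,1,2,4,5]), (7,[0,7,8,6,9,10,3,1,2,4,5]),
     (6,[0,7,6,8,10,9,2,1,3,5,4]), (7,[0,7,8,6,9,10,2,1,3,5,4]), (7,[0,1,3,2,5,4,8,7,6,10,9]),
     (7,[0,1,2,3,4,5,8,7,6,10,9])],
    Colour [0,0,0,3,3,1,3,1,1,3,3,1,1,1,0,1,1,2,2,2,2,0,2,2,2,2,2] [(6,[1,0,9,7,10,11,3,2,4,6,5]),
       (7,[1,0,7,9,11,10,3,2,4,6,5])])]"

lemma refutes_all_certificate_3K2: "refutes_all 4 base_3K2_K3 (map fst base_3K2_K3) certificate_3K2"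
  by code_simp

definition patterns_3K2 :: "rows list" where
  "patterns_3K2 = map fst base_3K2_K3 @ map (rows_of \<circ> fst) certificate_3K2"

text \<open>
  Let \<open>xy\<close> and \<open>ab\<close> be edges of \<open>J\<close> without edges in between. The nonneighbours of \<open>xy\<close> contain a pentagon
  \<open>a, b, v, z, u\<close>, whose vertices are added to \<open>J\<close> in the order \<open>u, v, z\<close>.
\<close>

definition refutes_pentagon :: "(rows \<times> rows) list \<Rightarrow> rows list \<Rightarrow> rows \<Rightarrow> nat \<Rightarrow> nat \<Rightarrow> nat \<Rightarrow> nat \<Rightarrow>
    (nat \<times> nat list) list \<Rightarrow> (nat \<times> nat list) list \<Rightarrow> (nat \<times> nat list) list \<Rightarrow> bool" where
  "refutes_pentagon B P J x y a b hs_u hs_v hs_z \<longleftrightarrow>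
     copy (adj J) {..<length J} [x, y, a, b] (matching_rows 2) \<and>
     list_all (\<lambda>s. list_all (\<lambda>t.
         labelled_types B P hs_z (t # s # J) (0 # 1 # map (\<lambda>i. i + 2) [a, b, x, y])
           [True, True, False, False, False, False] = [])
       (labelled_types B P hs_v (s # J) (0 # map Suc [a, b, x, y]) [False, False, True, False, False]))
     (labelled_types B P hs_u J [a, b, x, y] [True, False, False, False])"

definition joined_pentagons :: rows where
  "joined_pentagons = rows_of [[4,6],[3,4,7,8],[3,5],[],[],[8],[7],[],[]]"

lemma joined_pentagons_refuted:
  "refutes_pentagon base_3K2_K3 patterns_3K2 joined_pentagons 6 7 8 5 [(2,[0,9,4,6,3,1,5,2,8,7])] [] []"
  by code_simp

definition C5_K2 :: rows where
  "C5_K2 = rows_of [[1,4],[2],[3],[4],[],[6],[]]"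

lemma C5_K2_rows: "C5_K2 = [[True, False, False, True, False, False], [True, False, False, False, False],
    [True, False, False, False], [True, False, False], [False, False], [True], []]"
  by code_simp

lemma C5_K2_refuted:
  "refutes_pentagon base_3K2_K3 (patterns_3K2 @ [joined_pentagons]) C5_K2 0 1 5 6 []
     [(9,[6,4,7,1,5,8,2,3,0]), (9,[8,5,2,6,0,3,7,1,4]), (9,[7,6,4,5,1,3,8,0,2])]
     [(9,[8,0,4,5,2,3,9,1,7]), (9,[2,1,4,5,0,3,8,9,7]), (9,[4,2,9,8,5,1,3,7,0]),
      (5,[9,1,8,0,2,5,6,7,3,4]), (4,[0,1,2,9,8,7,6,5,4,3]), (3,[0,2,1,8,9,5,6,7,3,4]),
      (4,[6,7,5,3,4,2,0,1,9,8]), (3,[0,2,1,8,9,7,6,5,4,3]), (3,[0,1,2,9,8,5,6,7,3,4]),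
      (3,[6,5,7,4,3,2,0,1,9,8]), (8,[6,5,7,4,3,2,0,1,9,8])]"
  by code_simp

context critical_graph
begin

lemma not_2_colorable_nonneighbours:
  assumes "k = 4" "\<not> contains E V (clique_rows 3)" "x \<in> V" "y \<in> V"
  shows "\<not> colorable E {v \<in> V. \<not> E v x \<and> \<not> E v y} 2"
proof
  let ?M = "{v \<in> V. \<not> E v x \<and> \<not> E v y}"
  assume M: "colorable E ?M 2"
  have neighbours: "colorable E {v \<in> V. E v w} 1" if "w \<in> V" for w
    using no_triangle[OF assms(2)] that comm by (intro colorable_1_if_edgeless) auto
  then have "colorable E ({v \<in> V. E v x} \<union> {v \<in> V. E v y} \<union> ?M) (1 + 1 + 2)"
    by (intro colorable_Un neighbours M assms(3,4))
  then have "colorable E V (1 + 1 + 2)" by (rule colorable_subset) auto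
  then show False using not_colorable assms(1) by (simp add: numeral_eq_Suc)
qed

lemma ex_pentagon_in_nonneighbours:
  assumes "k = 4" and free: "\<not> contains E V (matching_rows 3)" "\<not> contains E V (clique_rows 3)"
    and xy: "x \<in> V" "y \<in> V" "E x y" and ab: "a \<in> M" "b \<in> M" "E a b"
    and M: "M = {v \<in> V. \<not> E v x \<and> \<not> E v y}"
  obtains v z u where "copy E M [a, b, v, z, u] C5"
proof -
  interpret M: simple_graph E M by unfold_locales
  have "\<not> contains E M (matching_rows 2)"
    using contains_matching_rows_Suc[OF xy, of 2] free(1)
    unfolding M by (auto simp: numeral_3_eq_3 numeral_2_eq_2)
  moreover have "\<not> contains E M (clique_rows 3)"
    using free(2) contains_mono[of E M] unfolding M by blast
  moreover have "\<not> colorable E M 2"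
    unfolding M by (rule not_2_colorable_nonneighbours[OF assms(1) free(2) xy(1,2)])
  ultimately show thesis using M.ex_pentagon_through_edge ab that by blast
qed

lemma pentagon_refuted:
  assumes "k = 4" "avoids E V (map fst B)" "avoids E V P"
    and "\<not> contains E V (matching_rows 3)" "\<not> contains E V (clique_rows 3)"
    and refuted: "refutes_pentagon B P J x y a b hs_u hs_v hs_z"
  shows "\<not> contains E V J"
proof
  assume "contains E V J"
  then obtain xs where xs: "copy E V xs J" unfolding contains_def by blast
  have matching: "copy (adj J) {..<length J} [x, y, a, b] (matching_rows 2)"
    using refuted unfolding refutes_pentagon_def by blast
  then have less: "x < length xs" "y < length xs" "a < length xs" "b < length xs"
    using copy_length[OF xs] by (auto simp: numeral_2_eq_2 split: if_splits)
  define M where "M = {v \<in> V. \<not> E v (xs ! x) \<and> \<not> E v (xs ! y)}"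
  interpret M: simple_graph E M by unfold_locales
  have edges: "xs ! x \<in> V" "xs ! y \<in> V" "E (xs ! x) (xs ! y)" "xs ! a \<in> M" "xs ! b \<in> M" "E (xs ! a) (xs ! b)"
    using copy_trans[OF xs matching] by (auto simp: numeral_2_eq_2 M_def comm split: if_splits)
  obtain v z u where "copy E M [xs ! a, xs ! b, v, z, u] C5"
    by (rule ex_pentagon_in_nonneighbours[OF assms(1,4,5) edges M_def])
  then have "{u, v, z} \<subseteq> M" "E (xs ! a) (xs ! b)" "E (xs ! b) v" "E v z" "E z u" "E u (xs ! a)"
    "\<not> E (xs ! a) v" "\<not> E (xs ! b) z" "\<not> E v u" "\<not> E z (xs ! a)" "\<not> E u (xs ! b)"
    unfolding M.copy_C5_iff by auto
  then have pentagon: "{u, v, z} \<subseteq> V" "map (E u) (map ((!) xs) [a, b, x, y]) = [True, False, False, False]"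
    "map (E v) (u # map ((!) xs) [a, b, x, y]) = [False, False, True, False, False]"
    "map (E z) (v # u # map ((!) xs) [a, b, x, y]) = [True, True, False, False, False, False]"
    by (auto simp: M_def comm)
  note possible = labelled_types_complete[OF assms(2,3)]
  have "map (E u) xs \<in> set (labelled_types B P hs_u J [a, b, x, y] [True, False, False, False])"
    by (rule possible) (use xs pentagon less in simp_all)
  moreover have "map (E v) (u # xs) \<in> set (labelled_types B P hs_v (map (E u) xs # J)
      (0 # map Suc [a, b, x, y]) [False, False, True, False, False])"
    by (rule possible) (use xs pentagon less in simp_all)
  moreover have "map (E z) (v # u # xs) \<in> set (labelled_types B P hs_z (map (E v) (u # xs) # map (E u) xs # J)
      (0 # 1 # map (\<lambda>i. i + 2) [a, b, x, y]) [True, True, False, False, False, False])"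
    by (rule possible) (use xs pentagon less in simp_all)
  ultimately show False
    using refuted unfolding refutes_pentagon_def list_all_iff by fastforce
qed

end

theorem (in simple_graph) colorable_4_if_3K2_K3_free:
  assumes "finite V" "\<not> contains E V (matching_rows 3)" "\<not> contains E V (clique_rows 3)"
  shows "colorable E V 4"
proof (rule ccontr)
  assume "\<not> colorable E V 4"
  from ex_critical_subgraph[OF assms(1) this] obtain W where W: "W \<subseteq> V" "critical_graph E W 4" by blast
  interpret W: critical_graph E W 4 by (rule W(2))
  have free: "\<not> contains E W (matching_rows 3)" "\<not> contains E W (clique_rows 3)"
    using assms(2,3) W(1) contains_mono by blast+
  then have base: "avoids E W (map fst base_3K2_K3)" by (simp add: fst_base_3K2_K3)
  then have patterns: "avoids E W patterns_3K2"
    unfolding patterns_3K2_def using W.refutes_all_sound refutes_all_certificate_3K2 by blast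
  then have "avoids E W (patterns_3K2 @ [joined_pentagons])"
    using W.pentagon_refuted[OF refl base _ free joined_pentagons_refuted] by simp
  then have no_C5_K2: "\<not> contains E W C5_K2"
    using W.pentagon_refuted[OF refl base _ free C5_K2_refuted] by blast
  obtain x y where xy: "x \<in> W" "y \<in> W" "E x y"
    using ex_edge_if_not_colorable[OF W.not_colorable] by auto
  define M where "M = {v \<in> W. \<not> E v x \<and> \<not> E v y}"
  have "\<not> colorable E M 2"
    unfolding M_def by (rule W.not_2_colorable_nonneighbours[OF refl free(2) xy(1,2)])
  then obtain a b where ab: "a \<in> M" "b \<in> M" "E a b" by (rule ex_edge_if_not_colorable) simp
  interpret M: simple_graph E M by unfold_locales
  obtain v z u where "copy E M [a, b, v, z, u] C5"
    by (rule W.ex_pentagon_in_nonneighbours[OF refl free xy ab M_def])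
  then have "{u, v, z} \<subseteq> M" "E a b" "E b v" "E v z" "E z u" "E u a"
    "\<not> E a v" "\<not> E b z" "\<not> E v u" "\<not> E z a" "\<not> E u b"
    unfolding M.copy_C5_iff by auto
  moreover have "w \<in> W" "\<not> E w x" "\<not> E w y" "\<not> E x w" "\<not> E y w" if "w \<in> M" for w
    using that W.comm by (auto simp: M_def)
  ultimately have "copy E W [a, b, v, z, u, x, y] C5_K2"
    using xy ab(1,2) by (auto simp: C5_K2_rows dest: W.sym)
  then show False using no_C5_K2 unfolding contains_def by blast
qed


section \<open>Colouring by a maximum clique\<close>

definition butterfly_rows :: rows where
  "butterfly_rows = rows_of [[1,2,3,4],[2],[],[4],[]]"

lemma butterfly_rows_eq:
  "butterfly_rows = [[True, True, True, True], [True, False, False], [False, False], [True], []]"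
  by code_simp

lemma card_triangle: "card (SIGMA j:{..<m}. {..j}) = (m + 1) choose 2"
proof -
  have "(\<Sum>j<m. Suc j) = (m + 1) choose 2"
    by (induction m) (auto simp: numeral_2_eq_2)
  then show ?thesis by simp
qed

locale maximum_clique = simple_graph +
  fixes vs :: "'a list"
  assumes clique: "set vs \<subseteq> V" "sorted_wrt E vs"
    and maximum: "\<not> contains E V (clique_rows (Suc (length vs)))"
begin

definition missed :: "'a \<Rightarrow> nat list" where
  "missed v = filter (\<lambda>i. \<not> E v (vs ! i)) [0..<length vs]"

definition colour :: "'a \<Rightarrow> nat \<times> nat" where
  "colour v = (let js = take 2 (missed v) in (last js, hd js))"

lemma adjacent_nth: "i < length vs \<Longrightarrow> j < length vs \<Longrightarrow> i \<noteq> j \<Longrightarrow> E (vs ! i) (vs ! j)"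
  using clique(2) sym by (metis linorder_neqE_nat sorted_wrt_nth_less)

lemma sorted_missed: "sorted_wrt (<) (missed v)"
  by (simp add: missed_def sorted_wrt_filter)

lemma set_missed: "set (missed v) = {i. i < length vs \<and> \<not> E v (vs ! i)}"
  by (auto simp: missed_def)

lemma missed_nonempty:
  assumes "v \<in> V"
  shows "missed v \<noteq> []"
proof
  assume "missed v = []"
  then have "E v w" if "w \<in> set vs" for w
    using that set_missed[of v] by (auto simp: in_set_conv_nth)
  then have "sorted_wrt E (v # vs)" using clique(2) by simp
  then show False using no_clique[OF maximum, of "v # vs"] clique(1) assms by simp
qed

lemma adjacent_not_both_miss_only:
  assumes "u \<in> V" "v \<in> V" "E u v" "missed u = [i]"
  shows "missed v \<noteq> [i]"
proof
  assume v: "missed v = [i]"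
  have i: "i < length vs" using set_missed[of u] assms(4) by auto
  define ws where "ws = take i vs @ drop (Suc i) vs"
  have "sorted_wrt E (take i vs @ vs ! i # drop (Suc i) vs)"
    using clique(2) id_take_nth_drop[OF i] by simp
  then have "sorted_wrt E ws" by (simp add: ws_def sorted_wrt_append)
  moreover have "set ws \<subseteq> V" "Suc (length ws) = length vs"
    using clique(1) i by (auto simp: ws_def dest: in_set_takeD in_set_dropD)
  moreover have "E x w" if xw: "x \<in> {u, v}" "w \<in> set ws" for x w
  proof -
    have "missed x = [i]" using xw(1) v assms(4) by auto
    then have nth: "E x (vs ! l)" if "l < length vs" "l \<noteq> i" for l
      using set_missed[of x] that by auto
    consider l where "l < i" "w = vs ! l" | l where "l < length vs - Suc i" "w = vs ! (Suc i + l)"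
      using xw(2) i by (auto simp: ws_def in_set_conv_nth)
    then show ?thesis using i by cases (simp_all add: nth)
  qed
  ultimately have "sorted_wrt E (u # v # ws)" using assms(3) by simp
  then show False
    using no_clique[OF maximum, of "u # v # ws"] assms(1,2) i \<open>set ws \<subseteq> V\<close> \<open>Suc (length ws) = _\<close> by simp
qed

lemma colour_cases:
  assumes "v \<in> V"
  obtains i where "missed v = [i]" "colour v = (i, i)"
    | i j js where "missed v = i # j # js" "i < j" "colour v = (j, i)"
proof (cases "missed v" rule: list.exhaust[case_names Nil Cons])
  case Nil
  then show ?thesis using missed_nonempty[OF assms] by simp
next
  case (Cons i js)
  then show ?thesis using that sorted_missed[of v] by (cases js) (auto simp: colour_def)
qed

lemma colour_in:
  assumes "v \<in> V"
  shows "colour v \<in> (SIGMA j:{..<length vs}. {..j})"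
  by (cases rule: colour_cases[OF assms]) (use set_missed[of v] in auto)

lemma same_colour:
  assumes "u \<in> V" "v \<in> V" "E u v" "colour u = colour v"
  obtains i j where "colour u = (j, i)" "i < j" "j < length vs"
    "\<And>w l. w \<in> {u, v} \<Longrightarrow> l \<le> j \<Longrightarrow> E w (vs ! l) \<longleftrightarrow> l \<noteq> i \<and> l \<noteq> j"
proof (cases rule: colour_cases[OF assms(1)])
  case (1 i)
  then have "missed v = [i]" using assms(4) by (cases rule: colour_cases[OF assms(2)]) auto
  then show ?thesis using adjacent_not_both_miss_only[OF assms(1-3)] 1(1) by blast
next
  case (2 i j js)
  then obtain js' where v: "missed v = i # j # js'"
    using assms(4) by (cases rule: colour_cases[OF assms(2)]) auto
  show ?thesis
  proof (rule that[OF 2(3,2)])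
    show "j < length vs" using set_missed[of u] 2(1) by auto
    show "E w (vs ! l) \<longleftrightarrow> l \<noteq> i \<and> l \<noteq> j" if wl: "w \<in> {u, v}" "l \<le> j" for w l
    proof -
      obtain ks where w: "missed w = i # j # ks" using wl(1) 2(1) v by (cases "w = u") auto
      then have "l \<in> set (missed w) \<longleftrightarrow> l = i \<or> l = j"
        using sorted_missed[of w] wl(2) by auto
      then show ?thesis using \<open>j < length vs\<close> wl(2) set_missed[of w] by auto
    qed
  qed
qed

lemma colorable_if_2K2_free:
  assumes "\<not> contains E V (matching_rows 2)"
  shows "colorable E V ((length vs + 1) choose 2)"
proof (rule colorableI)
  show "colour ` V \<subseteq> (SIGMA j:{..<length vs}. {..j})" using colour_in by blast
  show "colour u \<noteq> colour v" if uv: "u \<in> V" "v \<in> V" "E u v" for u v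
  proof
    assume "colour u = colour v"
    from same_colour[OF uv this] obtain i j where ij: "i < j" "j < length vs"
      and missed: "\<And>w l. w \<in> {u, v} \<Longrightarrow> l \<le> j \<Longrightarrow> E w (vs ! l) \<longleftrightarrow> l \<noteq> i \<and> l \<noteq> j" by metis
    have "E (vs ! i) (vs ! j)" "{u, v, vs ! i, vs ! j} \<subseteq> V"
      using adjacent_nth ij clique(1) uv by auto
    then show False
      using edges_joined_if_2K2_free[OF assms, of u v "vs ! i" "vs ! j"] missed[of u] missed[of v] ij uv(3)
      by auto
  qed
qed (simp_all only: card_triangle finite_SigmaI finite_lessThan finite_atMost order_refl)

lemma colorable_neighbours_if_butterfly_free:
  assumes "\<not> contains E V butterfly_rows" "2 \<le> length vs"
  shows "colorable E {v \<in> V. E v (vs ! 0) \<or> E v (vs ! 1)} (((length vs + 1) choose 2) - 1)"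
    (is "colorable E ?N _")
proof (rule colorableI)
  have not_1_0: "colour v \<noteq> (1, 0)" if "v \<in> ?N" for v
  proof
    assume "colour v = (1, 0)"
    moreover have "v \<in> V" using that by simp
    ultimately have "{0, 1} \<subseteq> set (missed v)" by (elim colour_cases) auto
    then show False using that set_missed[of v] by auto
  qed
  show "colour ` ?N \<subseteq> (SIGMA j:{..<length vs}. {..j}) - {(1, 0)}"
    using colour_in not_1_0 by (intro image_subsetI) simp
  show "card ((SIGMA j:{..<length vs}. {..j}) - {(1, 0)}) \<le> ((length vs + 1) choose 2) - 1"
    using assms(2) card_triangle[of "length vs"] by (simp add: card_Diff_singleton_if del: card_SigmaI)
  show "colour u \<noteq> colour v" if uv: "u \<in> ?N" "v \<in> ?N" "E u v" for u v
  proof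
    assume same: "colour u = colour v"
    have "u \<in> V" "v \<in> V" using uv by auto
    from same_colour[OF this uv(3) same] obtain i j where ij: "colour u = (j, i)" "i < j" "j < length vs"
      and missed: "\<And>w l. w \<in> {u, v} \<Longrightarrow> l \<le> j \<Longrightarrow> E w (vs ! l) \<longleftrightarrow> l \<noteq> i \<and> l \<noteq> j" by metis
    define l :: nat where "l = (if i = 0 then 1 else 0)"
    have l: "l < j" "l \<noteq> i"
      using ij(1,2) not_1_0[OF uv(1)] by (auto simp: l_def)
    have w: "E (vs ! l) w" "\<not> E w (vs ! i)" "\<not> E w (vs ! j)" if "w \<in> {u, v}" for w
      using missed[OF that] ij l sym by auto
    have "E (vs ! l) (vs ! i)" "E (vs ! l) (vs ! j)" "E (vs ! i) (vs ! j)"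
      using adjacent_nth ij l by auto
    moreover have "{vs ! l, u, v, vs ! i, vs ! j} \<subseteq> V"
      using clique(1) ij l \<open>u \<in> V\<close> \<open>v \<in> V\<close> by auto
    ultimately have "copy E V [vs ! l, u, v, vs ! i, vs ! j] butterfly_rows"
      using w[of u] w[of v] uv(3) by (simp add: butterfly_rows_eq)
    then show False using assms(1) unfolding contains_def by blast
  qed
qed simp

lemma colorable_length_if_length_le_1:
  assumes "length vs \<le> 1"
  shows "colorable E V (length vs)"
proof (cases "length vs = 0")
  case True
  then have "V = {}" using no_clique[OF maximum, of "[v]" for v] by auto
  then show ?thesis by (simp add: colorable_def)
next
  case False
  then have "length vs = 1" using assms by linarith
  then show ?thesis using no_clique[OF maximum, of "[u, v]" for u v] colorable_1_if_edgeless[of V E] by auto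
qed

end

lemma (in simple_graph) ex_maximum_clique:
  assumes "\<not> contains E V (clique_rows (Suc m))"
  obtains vs where "maximum_clique E V vs" "length vs \<le> m"
proof -
  define n where "n = (LEAST n. \<not> contains E V (clique_rows (Suc n)))"
  have max: "\<not> contains E V (clique_rows (Suc n))" "n \<le> m"
    unfolding n_def by (rule LeastI Least_le, rule assms)+
  have "contains E V (clique_rows n)"
  proof (cases n)
    case 0
    then show ?thesis unfolding contains_def by (auto intro: exI[of _ "[]"])
  next
    case (Suc n')
    then show ?thesis
      using not_less_Least[of n' "\<lambda>n. \<not> contains E V (clique_rows (Suc n))"] by (simp add: n_def)
  qed
  then obtain vs where "length vs = n" "set vs \<subseteq> V" "sorted_wrt E vs"
    unfolding contains_def copy_clique_rows_iff by blast
  with max show thesis by (intro that[of vs]) (unfold_locales, auto)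
qed


section \<open>The bound\<close>

lemma chi_bound_0: "chi_bound p 0 = 0"
  by (subst chi_bound.simps) simp

lemma choose_2_mono: "m \<le> n \<Longrightarrow> m choose 2 \<le> n choose 2"
  unfolding choose_two by (intro div_le_mono mult_le_mono diff_le_mono) auto

lemma chi_bound_2_le_Suc: "chi_bound 2 m \<le> chi_bound 2 (Suc m)"
proof -
  consider "m = 0" | "m = 1" | "m = 2" | "m = 3" | "4 \<le> m" by linarith
  then show ?thesis
  proof cases
    case 5
    then show ?thesis
      using chi_bound_clauses(4)[of m] chi_bound_clauses(4)[of "Suc m"] choose_2_mono[of "m + 1" "Suc m + 1"]
      by simp
  qed (use chi_bound_clauses(1)[of 2] chi_bound_clauses(2,3) chi_bound_clauses(4)[of 4] in
      \<open>simp_all add: chi_bound_0 choose_two eval_nat_numeral\<close>)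
qed

lemma chi_bound_le_Suc:
  assumes "2 \<le> p"
  shows "chi_bound p m \<le> chi_bound p (Suc m)"
  using assms
proof (induction p rule: dec_induct)
  case base
  show ?case by (rule chi_bound_2_le_Suc)
next
  case (step p)
  have rec: "chi_bound (Suc p) l = chi_bound p l + ((l + 1) choose 2) - 1" if "3 \<le> l" for l
    using chi_bound_clauses(6)[OF that, of "Suc p"] step.hyps by simp
  have at_2: "chi_bound (Suc p) 2 = 2 * p" using chi_bound_clauses(5)[of "Suc p"] step.hyps by simp
  consider "m = 0" | "m = 1" | "m = 2" | "3 \<le> m" by linarith
  then show ?case
  proof cases
    case 1
    then show ?thesis by (simp add: chi_bound_0)
  next
    case 2
    then show ?thesis using chi_bound_clauses(1)[of "Suc p"] at_2 step.hyps by (simp add: numeral_2_eq_2)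
  next
    case 3
    have "2 * p - 2 \<le> chi_bound p 2"
      using chi_bound_clauses(2) chi_bound_clauses(5)[of p] step.hyps by (cases "p = 2") auto
    also have "\<dots> \<le> chi_bound p 3" using step.IH 3 by (simp add: numeral_3_eq_3 numeral_2_eq_2)
    finally show ?thesis using at_2 rec[of 3] 3 by (simp add: choose_two)
  next
    case 4
    then show ?thesis
      using rec[of m] rec[of "Suc m"] step.IH choose_2_mono[of "m + 1" "Suc m + 1"] by simp
  qed
qed

lemma chi_bound_mono: "2 \<le> p \<Longrightarrow> m \<le> n \<Longrightarrow> chi_bound p m \<le> chi_bound p n"
  using lift_Suc_mono_le[of "chi_bound p"] chi_bound_le_Suc by blast

lemma chi_bound_step:
  assumes "3 \<le> p" "2 \<le> m" "p \<noteq> 3 \<or> m \<noteq> 2"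
  shows "((m + 1) choose 2) - 1 + chi_bound (p - 1) m \<le> chi_bound p m"
proof (cases "m = 2")
  case True
  have "chi_bound p 2 = 2 * p - 2" "chi_bound (p - 1) 2 = 2 * (p - 1) - 2"
    using chi_bound_clauses(5)[of p] chi_bound_clauses(5)[of "p - 1"] assms True by auto
  then show ?thesis using True assms by (simp add: choose_two)
next
  case False
  moreover have "1 \<le> (m + 1) choose 2" using assms(2) by (simp add: Suc_le_eq)
  ultimately show ?thesis using chi_bound_clauses(6)[of m p] assms by simp
qed

context maximum_clique
begin

lemma colorable_chi_bound_2:
  assumes "finite V" "\<not> contains E V (matching_rows 2)"
  shows "colorable E V (chi_bound 2 (length vs))"
proof -
  have wagon: "colorable E V ((length vs + 1) choose 2)" by (rule colorable_if_2K2_free[OF assms(2)])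
  consider "length vs \<le> 1" | "length vs = 2" | "length vs = 3" | "4 \<le> length vs" by linarith
  then show ?thesis
  proof cases
    case 1
    then have "chi_bound 2 (length vs) = length vs"
      using chi_bound_0 chi_bound_clauses(1)[of 2] by (cases "length vs") auto
    then show ?thesis using colorable_length_if_length_le_1[OF 1] by simp
  next
    case 2
    then show ?thesis using wagon chi_bound_clauses(2) by (simp add: choose_two)
  next
    case 3
    then show ?thesis using colorable_4_if_2K2_K4_free[OF assms] maximum chi_bound_clauses(3) by simp
  next
    case 4
    then show ?thesis using wagon chi_bound_clauses(4) by simp
  qed
qed

lemma colorable_chi_bound_step:
  assumes "3 \<le> p" "finite V" "\<not> contains E V (matching_rows p)" "\<not> contains E V butterfly_rows"
    and nonneighbours: "\<And>x y. x \<in> V \<Longrightarrow> y \<in> V \<Longrightarrow> E x y \<Longrightarrow>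
      colorable E {v \<in> V. \<not> E v x \<and> \<not> E v y} (chi_bound (p - 1) (length vs))"
  shows "colorable E V (chi_bound p (length vs))"
proof -
  consider "length vs \<le> 1" | "p = 3" "length vs = 2" | "2 \<le> length vs" "p \<noteq> 3 \<or> length vs \<noteq> 2" by linarith
  then show ?thesis
  proof cases
    case 1
    then have "chi_bound p (length vs) = length vs"
      using chi_bound_0 chi_bound_clauses(1)[of p] assms(1) by (cases "length vs") auto
    then show ?thesis using colorable_length_if_length_le_1[OF 1] by simp
  next
    case 2
    then show ?thesis
      using colorable_4_if_3K2_K3_free[OF assms(2)] assms(3) maximum chi_bound_clauses(5)[of 3] by simp
  next
    case 3
    let ?N = "{v \<in> V. E v (vs ! 0) \<or> E v (vs ! 1)}" and ?M = "{v \<in> V. \<not> E v (vs ! 0) \<and> \<not> E v (vs ! 1)}"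
    have "colorable E ?N (((length vs + 1) choose 2) - 1)"
      by (rule colorable_neighbours_if_butterfly_free[OF assms(4) 3(1)])
    moreover have less: "0 < length vs" "1 < length vs" using 3(1) by linarith+
    have "vs ! 0 \<in> V" "vs ! 1 \<in> V" "E (vs ! 0) (vs ! 1)"
      using adjacent_nth[OF less] nth_mem[OF less(1)] nth_mem[OF less(2)] clique(1) by auto
    then have "colorable E ?M (chi_bound (p - 1) (length vs))" by (rule nonneighbours)
    ultimately have "colorable E (?N \<union> ?M) (((length vs + 1) choose 2) - 1 + chi_bound (p - 1) (length vs))"
      by (rule colorable_Un)
    moreover have "?N \<union> ?M = V" by blast
    ultimately show ?thesis using chi_bound_step[OF assms(1) 3] colorable_mono by metis
  qed
qed

end

theorem colorable_chi_bound:
  assumes "2 \<le> p" "simple_graph E" "finite V"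
    and "avoids E V [matching_rows p, butterfly_rows, clique_rows (Suc m)]"
  shows "colorable E V (chi_bound p m)"
  using assms(1,3,4)
proof (induction p arbitrary: V m rule: dec_induct)
  case base
  interpret simple_graph E V by (rule assms(2))
  obtain vs where vs: "maximum_clique E V vs" "length vs \<le> m"
    using ex_maximum_clique base.prems(2) by auto
  have "colorable E V (chi_bound 2 (length vs))"
    using maximum_clique.colorable_chi_bound_2[OF vs(1)] base.prems by simp
  then show ?case using colorable_mono chi_bound_mono[OF order_refl vs(2)] by blast
next
  case (step p)
  interpret simple_graph E V by (rule assms(2))
  obtain vs where vs: "maximum_clique E V vs" "length vs \<le> m"
    using ex_maximum_clique step.prems(2) by auto
  interpret maximum_clique E V vs by (rule vs(1))
  have "colorable E {v \<in> V. \<not> E v x \<and> \<not> E v y} (chi_bound p (length vs))"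
    if "x \<in> V" "y \<in> V" "E x y" for x y
  proof (rule step.IH)
    let ?M = "{v \<in> V. \<not> E v x \<and> \<not> E v y}"
    have "avoids E V [butterfly_rows, clique_rows (Suc (length vs))]"
      using step.prems(2) maximum by simp
    then have "avoids E ?M [butterfly_rows, clique_rows (Suc (length vs))]"
      by (rule avoids_subset) auto
    then show "avoids E ?M [matching_rows p, butterfly_rows, clique_rows (Suc (length vs))]"
      using contains_matching_rows_Suc[OF that] step.prems(2) by auto
  qed (use step.prems(1) in simp)
  then have "colorable E V (chi_bound (Suc p) (length vs))"
    using colorable_chi_bound_step[of "Suc p"] step.hyps(1) step.prems by simp
  then show ?case using colorable_mono chi_bound_mono[OF _ vs(2), of "Suc p"] step.hyps(1) by auto
qed


section \<open>Forbidden induced subgraphs\<close>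

lemma not_free_of_if_embedding:
  assumes "F \<in> \<F>" "pair_graph G" "pair_graph F" "inj_on f (pverts F)" "f ` pverts F \<subseteq> pverts G"
    and arcs: "\<And>i j. i \<in> pverts F \<Longrightarrow> j \<in> pverts F \<Longrightarrow> (i, j) \<in> parcs F \<longleftrightarrow> (f i, f j) \<in> parcs G"
  shows "\<not> free_of \<F> G"
proof -
  interpret G: pair_graph G by fact
  interpret F: pair_graph F by fact
  define H where "H = with_proj G \<restriction> f ` pverts F"
  define hom where "hom = \<lparr>iso_verts = f, iso_arcs = map_prod f f, iso_head = snd, iso_tail = fst\<rparr>"
  have parcs_F: "parcs F \<subseteq> pverts F \<times> pverts F"
    using F.arc_fst_in_verts F.arc_snd_in_verts by fastforce
  have "inj_on (map_prod f f) (parcs F)"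
    by (rule inj_on_subset[OF map_prod_inj_on[OF assms(4,4)] parcs_F])
  then have iso: "pre_digraph.digraph_isomorphism (with_proj F) hom"
    unfolding pre_digraph.digraph_isomorphism_def using assms(4) F.wf_digraph_axioms by (auto simp: hom_def)
  have "map_prod f f ` parcs F = {e \<in> parcs G. fst e \<in> f ` pverts F \<and> snd e \<in> f ` pverts F}"
    using parcs_F arcs by (force simp: image_iff)
  then have "H = app_iso hom (with_proj F)"
    unfolding H_def hom_def app_iso_def induce_subgraph_def by simp
  with iso have "digraph_iso (with_proj F) H" unfolding digraph_iso_def by blast
  then have "digraph_iso H (with_proj F)" by (rule digraph_iso_swap[OF F.wf_digraph_axioms])
  moreover have "induced_subgraph H (with_proj G)"
    unfolding H_def using assms(5) by (intro G.induced_induce) simp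
  ultimately show ?thesis using assms(1) unfolding free_of_def by blast
qed

definition twin_free :: "rows \<Rightarrow> bool" where
  "twin_free Q \<longleftrightarrow> distinct (map (\<lambda>i. map (adj Q i) [0..<length Q]) [0..<length Q])"

lemma twin_freeI:
  assumes "\<And>i j. i < length Q \<Longrightarrow> j < length Q \<Longrightarrow> i \<noteq> j \<Longrightarrow> \<exists>k<length Q. adj Q i k \<noteq> adj Q j k"
  shows "twin_free Q"
  using assms unfolding twin_free_def distinct_map inj_on_def by fastforce

lemma (in simple_graph) copy_distinct:
  assumes "copy E V xs Q" "twin_free Q"
  shows "distinct xs"
proof -
  have "map (adj Q i) [0..<length Q] = map (\<lambda>k. E (xs ! i) (xs ! k)) [0..<length Q]" if "i < length Q" for i
    using that adj_copy[OF assms(1)] by simp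
  then have "xs ! i \<noteq> xs ! j" if "i < length Q" "j < length Q" "i \<noteq> j" for i j
    using assms(2) that unfolding twin_free_def distinct_map by (auto simp: inj_on_def)
  then show ?thesis using copy_length[OF assms(1)] by (simp add: distinct_conv_nth)
qed

lemma (in simple_graph) sorted_wrt_imp_clique: "sorted_wrt E xs \<Longrightarrow> distinct xs \<and> pairwise E (set xs)"
  by (induction xs) (auto simp: pairwise_insert comm irrefl)

lemma adj_matching_rows:
  "i < 2 * p \<Longrightarrow> j < 2 * p \<Longrightarrow> adj (matching_rows p) i j \<longleftrightarrow> i \<noteq> j \<and> i div 2 = j div 2"
proof (induction p arbitrary: i j)
  case (Suc p)
  have split: "n = 0 \<or> n = 1 \<or> (\<exists>n'<2 * p. n = Suc (Suc n'))" if "n < 2 * Suc p" for n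
    using that by (cases n; cases "n - 1") auto
  show ?case using split[OF Suc.prems(1)] split[OF Suc.prems(2)] Suc.IH by auto
qed simp

lemma pair_graph_simple_graph:
  assumes "pair_graph G"
  shows "simple_graph (\<lambda>u v. (u, v) \<in> parcs G)"
proof -
  interpret pair_graph G by (rule assms)
  show ?thesis using arcs_symmetric pair_no_loops by unfold_locales fastforce+
qed

lemma not_contains_if_free_of:
  assumes "pair_graph G" "free_of \<F> G" "F \<in> \<F>" "pair_graph F" "pverts F = {..<length Q}"
    and arcs: "\<And>i j. i < length Q \<Longrightarrow> j < length Q \<Longrightarrow> (i, j) \<in> parcs F \<longleftrightarrow> adj Q i j"
    and "twin_free Q"
  shows "\<not> contains (\<lambda>u v. (u, v) \<in> parcs G) (pverts G) Q"
proof
  interpret simple_graph "\<lambda>u v. (u, v) \<in> parcs G" "pverts G"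
    by (rule pair_graph_simple_graph[OF assms(1)])
  assume "contains (\<lambda>u v. (u, v) \<in> parcs G) (pverts G) Q"
  then obtain xs where xs: "copy (\<lambda>u v. (u, v) \<in> parcs G) (pverts G) xs Q"
    unfolding contains_def by blast
  have length: "length xs = length Q" by (rule copy_length[OF xs])
  have "inj_on ((!) xs) (pverts F)" "(!) xs ` pverts F \<subseteq> pverts G"
    using copy_distinct[OF xs assms(7)] copy_in[OF xs] nth_mem
    by (auto simp: assms(5) length[symmetric] inj_on_def nth_eq_iff_index_eq subset_iff)
  moreover have "(i, j) \<in> parcs F \<longleftrightarrow> (xs ! i, xs ! j) \<in> parcs G" if "i \<in> pverts F" "j \<in> pverts F" for i j
    using that arcs adj_copy[OF xs] assms(5) by simp
  ultimately have "\<not> free_of \<F> G"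
    by (rule not_free_of_if_embedding[OF assms(3,1,4)])
  then show False using assms(2) by simp
qed

lemma twin_free_matching_rows: "twin_free (matching_rows p)"
proof (rule twin_freeI)
  fix i j assume less: "i < length (matching_rows p)" "j < length (matching_rows p)" and "i \<noteq> j"
  show "\<exists>k<length (matching_rows p). adj (matching_rows p) i k \<noteq> adj (matching_rows p) j k"
  proof (cases "i div 2 = j div 2")
    case True
    then show ?thesis using less \<open>i \<noteq> j\<close> by (intro exI[of _ j]) (simp add: adj_matching_rows)
  next
    case False
    define k where "k = (if even i then i + 1 else i - 1)"
    have "k \<noteq> i" "k div 2 = i div 2" "k < 2 * p"
      using less by (auto simp: k_def elim!: evenE oddE)
    then show ?thesis using less False by (intro exI[of _ k]) (simp add: adj_matching_rows)
  qed
qed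

lemma parcs_matching_graph_iff:
  assumes "i < 2 * p" "j < 2 * p"
  shows "(i, j) \<in> parcs (matching_graph p) \<longleftrightarrow> i \<noteq> j \<and> i div 2 = j div 2"
proof
  assume "i \<noteq> j \<and> i div 2 = j div 2"
  then have "i div 2 < p"
    "i = 2 * (i div 2) \<and> j = 2 * (i div 2) + 1 \<or> i = 2 * (i div 2) + 1 \<and> j = 2 * (i div 2)"
    using assms(1) by presburger+
  then show "(i, j) \<in> parcs (matching_graph p)"
    unfolding matching_graph_def by (auto intro!: bexI[of _ "i div 2"])
qed (auto simp: matching_graph_def)

lemma not_contains_matching_rows:
  assumes "pair_graph G" "free_of \<F> G" "matching_graph p \<in> \<F>"
  shows "\<not> contains (\<lambda>u v. (u, v) \<in> parcs G) (pverts G) (matching_rows p)"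
proof (rule not_contains_if_free_of[OF assms pair_graph_matching_graph _ _ twin_free_matching_rows])
  show "pverts (matching_graph p) = {..<length (matching_rows p)}" by (simp add: matching_graph_def)
  show "(i, j) \<in> parcs (matching_graph p) \<longleftrightarrow> adj (matching_rows p) i j"
    if "i < length (matching_rows p)" "j < length (matching_rows p)" for i j
    using that by (simp add: parcs_matching_graph_iff adj_matching_rows)
qed

lemma not_contains_butterfly_rows:
  assumes "pair_graph G" "free_of \<F> G" "butterfly \<in> \<F>"
  shows "\<not> contains (\<lambda>u v. (u, v) \<in> parcs G) (pverts G) butterfly_rows"
proof (rule not_contains_if_free_of[OF assms pair_graph_butterfly])
  have length: "length butterfly_rows = 5" by (simp add: butterfly_rows_eq)
  then show "pverts butterfly = {..<length butterfly_rows}" by (auto simp: butterfly_def Let_def)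
  have "\<forall>i\<in>{..<5}. \<forall>j\<in>{..<5}. (i, j) \<in> parcs butterfly \<longleftrightarrow> adj butterfly_rows i j"
    by code_simp
  then show "(i, j) \<in> parcs butterfly \<longleftrightarrow> adj butterfly_rows i j"
    if "i < length butterfly_rows" "j < length butterfly_rows" for i j
    using that unfolding length by blast
  show "twin_free butterfly_rows" by code_simp
qed

lemma not_contains_clique_rows:
  assumes "pair_graph G"
  shows "\<not> contains (\<lambda>u v. (u, v) \<in> parcs G) (pverts G) (clique_rows (Suc (clique_number G)))"
proof
  interpret G: pair_graph G by (rule assms)
  interpret simple_graph "\<lambda>u v. (u, v) \<in> parcs G" "pverts G"
    by (rule pair_graph_simple_graph[OF assms])
  assume "contains (\<lambda>u v. (u, v) \<in> parcs G) (pverts G) (clique_rows (Suc (clique_number G)))"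
  then obtain xs where xs: "length xs = Suc (clique_number G)" "set xs \<subseteq> pverts G"
      "sorted_wrt (\<lambda>u v. (u, v) \<in> parcs G) xs"
    unfolding contains_def copy_clique_rows_iff by blast
  then have "clique G (set xs)" "card (set xs) = length xs"
    using sorted_wrt_imp_clique[of xs] distinct_card[of xs] by (simp_all add: clique_def)
  moreover have "finite {card K | K. clique G K}"
    by (rule finite_subset[of _ "card ` Pow (pverts G)"]) (auto simp: clique_def)
  ultimately have "card (set xs) \<le> clique_number G"
    unfolding clique_number_def by (intro Max_ge) blast+
  then show False using xs(1) \<open>card (set xs) = length xs\<close> by simp
qed

lemma chromatic_number_le_if_colorable:
  assumes "pair_graph G" "colorable (\<lambda>u v. (u, v) \<in> parcs G) (pverts G) k"
  shows "chromatic_number G \<le> k"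
proof -
  interpret pair_graph G by (rule assms(1))
  obtain c where "c ` pverts G \<subseteq> {..<k}" "\<forall>u\<in>pverts G. \<forall>v\<in>pverts G. (u, v) \<in> parcs G \<longrightarrow> c u \<noteq> c v"
    using assms(2) unfolding colorable_def by blast
  then have "proper_coloring G k c"
    using arc_fst_in_verts arc_snd_in_verts unfolding proper_coloring_def by force
  then show ?thesis unfolding chromatic_number_def by (blast intro: Least_le)
qed

theorem theorem3p8:
  fixes G :: "'a pair_pre_digraph" and p :: nat
  assumes "p \<ge> 2"
    and "pair_graph G"
    and "free_of {matching_graph p, butterfly} G"
  shows "chromatic_number G \<le> chi_bound p (clique_number G)"
proof (rule chromatic_number_le_if_colorable[OF assms(2)])
  interpret pair_graph G by (rule assms(2))
  have "avoids (\<lambda>u v. (u, v) \<in> parcs G) (pverts G)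
      [matching_rows p, butterfly_rows, clique_rows (Suc (clique_number G))]"
    using not_contains_matching_rows[OF assms(2,3)] not_contains_butterfly_rows[OF assms(2,3)]
      not_contains_clique_rows[OF assms(2)] by simp
  then show "colorable (\<lambda>u v. (u, v) \<in> parcs G) (pverts G) (chi_bound p (clique_number G))"
    using colorable_chi_bound[OF assms(1) pair_graph_simple_graph[OF assms(2)] pair_finite_verts] by blast
qed

end
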